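(* Let $X_1,\dots,X_n$ be independent random variables with values in $\mathbb{Z}_+$, and suppose that for each $i$ the probability generating function $M_{X_i}$ satisfies $G_{X_i}(z):=M_{X_i}'(z)/M_{X_i}(z)=\sum_{m=0}^\infty a_{i,m+1}z^m$. Let $Y=\sum_{i=1}^nX_i$ and $$\mu=\sum_{i=1}^n\sum_{m\ge0}a_{i,m+1},\quad \sigma^2=\sum_{i=1}^n\sum_{m\ge0}(m+1)a_{i,m+1},\quad \mu_2=\sum_{i=1}^n\sum_{m\ge0}m\,a_{i,m+1}.$$ Assume $\sigma^2>\mu$, set $p=\mu/\sigma^2$, $q=1-p$, $\alpha=\mu^2/\mu_2$, and let $Z\sim\mathrm{NB}(\alpha,p)$. Then $$d_{TV}(Y,Z)\le\frac{1}{\alpha q}\sqrt{\frac{2}{\pi}}\Bigl(\frac14+\sum_{i=1}^n\bigl(1-d_{TV}(X_i,X_i+1)\bigr)\Bigr)^{-1/2}\sum_{i=1}^n\sum_{l=1}^\infty l(l-1)\bigl|a_{i,l+1}-q\,a_{i,l}\bigr| .$$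
   Context: $\mathrm{NB}(\alpha,p)$: $\mathbf{P}(Z=m)=\binom{\alpha+m-1}{m}p^\alpha q^m$, $m\ge0$. $d_{TV}(Y,X)=\frac12\sum_{m\ge0}|\mathbf{P}(Y=m)-\mathbf{P}(X=m)|$; $X_i+1$ denotes the shifted random variable. The parameters $\alpha,p$ match the mean $\mu$ and variance $\sigma^2$ of $Y$. *)

theory Defs
  imports "HOL-Probability.Probability"
begin

definition dist_nat :: "'a measure \<Rightarrow> ('a \<Rightarrow> nat) \<Rightarrow> nat \<Rightarrow> real" where
  "dist_nat M V k = measure M {\<omega> \<in> space M. V \<omega> = k}"

definition pgf :: "(nat \<Rightarrow> real) \<Rightarrow> real \<Rightarrow> real" where
  "pgf f z = (\<Sum>m. f m * z ^ m)"

definition dtv :: "(nat \<Rightarrow> real) \<Rightarrow> (nat \<Rightarrow> real) \<Rightarrow> real" where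
  "dtv f g = (\<Sum>m. \<bar>f m - g m\<bar>) / 2"

definition shift1 :: "(nat \<Rightarrow> real) \<Rightarrow> nat \<Rightarrow> real" where
  "shift1 f m = (if m = 0 then 0 else f (m - 1))"

definition nb_pmf :: "real \<Rightarrow> real \<Rightarrow> nat \<Rightarrow> real" where
  "nb_pmf \<alpha> p m = ((\<alpha> + real m - 1) gchoose m) * p powr \<alpha> * (1 - p) ^ m"

end

theory Submission
  imports Defs
begin


text \<open>
  Laws on the naturals are treated as power series with the \<open>l\<^sup>1\<close> norm. The law \<open>F\<close> of \<open>Y\<close> satisfies
  \<open>F' = A * F\<close> with \<open>A = \<Sum>i. A\<^sub>i\<close>, so the Stein operator of the negative binomial distribution maps
  \<open>F\<close> to \<open>P * F\<close> with \<open>P = q * \<alpha> - (1 - q * X) * A\<close>. Matching two moments gives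
  \<open>P = (1 - X)\<^sup>2 * Q\<close>, where \<open>Q\<close> has norm at most \<open>1/2 * \<Sum>l. l * (l - 1) * |a\<^sub>l\<^sub>+\<^sub>1 - q * a\<^sub>l|\<close>. One
  factor \<open>1 - X\<close> is moved onto the Stein solution, whose increments are at most \<open>1 / (\<alpha> * q)\<close>; the
  other one yields the norm of \<open>(1 - X) * F\<close>, which is twice the total variation distance between
  \<open>Y\<close> and \<open>Y + 1\<close>.

  That norm is bounded by adding the summands one at a time. Each law is a mixture of uniform laws
  on intervals, and these are in turn mixtures of shifted convolution powers of a fair coin. For
  coins the bound is the central binomial estimate; the induction carries an arbitrary number of
  extra coins.
\<close>

subsection \<open>Formal power series with absolutely summable coefficients\<close>

text \<open>What makes the induction over the summands close is the shape of the invariant: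
  \<open>norm1 (fair ^ k * V) \<le> 2 / sqrt (g + 3/2 * k)\<close> for every \<open>k\<close>. A
  coin is worth 3/2 because the central binomial probability of \<open>2 * j\<close> coins is at
  most \<open>1 / sqrt (3 * j + 1)\<close>. A summand with overlap \<theta> lowers the bound by
  \<theta> times what two further coins would gain, that is, the drop of \<open>1 / sqrt\<close>
  over length 3. Read as a growth law, \<open>g / 3 + 3/4 * ln g\<close> may rise by \<theta>. So
  \<open>g\<close> depends on the total overlap only implicitly, and \<open>sqrt (2 / pi)\<close>
  and \<open>1/4\<close> appear only when \<open>g\<close> is finally compared with it.

  On the analytic side, the numbers \<open>a\<close> may have either sign, their sums may converge
  only conditionally, and the generating function identity is assumed only near 0. Hence
  \<open>A\<close> need not have finite norm, and the identity cannot simply be evaluated at 1. It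
  is used formally; the finite mean of \<open>F\<close> comes from a one-sided Abel argument, and
  absolute summability is derived for \<open>P\<close>, where the weighted hypothesis provides
  it.\<close>

definition l1 :: "real fps \<Rightarrow> bool" where
  "l1 F \<longleftrightarrow> summable (\<lambda>n. \<bar>fps_nth F n\<bar>)"

definition norm1 :: "real fps \<Rightarrow> real" where
  "norm1 F = (\<Sum>n. \<bar>fps_nth F n\<bar>)"

lemma norm1_nonneg: "l1 F \<Longrightarrow> 0 \<le> norm1 F"
  unfolding l1_def norm1_def by (rule suminf_nonneg) auto

lemma l1_add: "l1 F \<Longrightarrow> l1 G \<Longrightarrow> l1 (F + G)"
  unfolding l1_def
  by (rule summable_comparison_test'[of "\<lambda>n. \<bar>fps_nth F n\<bar> + \<bar>fps_nth G n\<bar>" 0])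
     (auto intro: summable_add)

lemma norm1_add: "l1 F \<Longrightarrow> l1 G \<Longrightarrow> norm1 (F + G) \<le> norm1 F + norm1 G"
  using l1_add[of F G] unfolding l1_def norm1_def
  by (subst suminf_add) (auto intro!: suminf_le summable_add)

lemma
  assumes "l1 F"
  shows l1_const_mult: "l1 (fps_const c * F)"
    and norm1_const_mult: "norm1 (fps_const c * F) = \<bar>c\<bar> * norm1 F"
  using assms unfolding l1_def norm1_def
  by (auto simp: abs_mult suminf_mult intro: summable_mult)

lemma
  assumes "l1 F" "l1 G"
  shows l1_mult: "l1 (F * G)"
    and norm1_mult: "norm1 (F * G) \<le> norm1 F * norm1 G"
proof -
  let ?c = "\<lambda>k. \<Sum>i\<le>k. \<bar>fps_nth F i\<bar> * \<bar>fps_nth G (k - i)\<bar>"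
  have s: "?c sums (norm1 F * norm1 G)"
    using Cauchy_product_sums[of "\<lambda>n. \<bar>fps_nth F n\<bar>" "\<lambda>n. \<bar>fps_nth G n\<bar>"] assms
    by (simp add: l1_def norm1_def)
  have le: "\<bar>fps_nth (F * G) k\<bar> \<le> ?c k" for k
    unfolding fps_mult_nth atLeast0AtMost
    by (rule order.trans[OF sum_abs]) (simp add: abs_mult)
  show 1: "l1 (F * G)"
    unfolding l1_def by (rule summable_comparison_test'[OF sums_summable[OF s], of 0]) (use le in auto)
  show "norm1 (F * G) \<le> norm1 F * norm1 G"
    unfolding norm1_def[of "F * G"] sums_unique[OF s]
    by (rule suminf_le) (use le 1 sums_summable[OF s] in \<open>auto simp: l1_def\<close>)
qed

lemma
  shows l1_X_power: "l1 (fps_X ^ k)" and norm1_X_power: "norm1 (fps_X ^ k) = 1"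
proof -
  have "(\<lambda>n. \<bar>fps_nth (fps_X ^ k :: real fps) n\<bar>) sums 1"
    using sums_single[of k "\<lambda>_. 1::real"]
    by (auto simp: fps_X_power_nth if_distrib cong: if_cong)
  then show "l1 (fps_X ^ k)" "norm1 (fps_X ^ k) = 1"
    by (auto simp: l1_def norm1_def sums_iff)
qed

lemma l1_X_power_mult: "l1 F \<Longrightarrow> l1 (fps_X ^ k * F)"
  by (intro l1_mult l1_X_power)

lemma norm1_X_power_mult: "l1 F \<Longrightarrow> norm1 (fps_X ^ k * F) \<le> norm1 F"
  using norm1_mult[OF l1_X_power, of F k] by (simp add: norm1_X_power)

lemma l1_sum: "(\<And>i. i \<in> I \<Longrightarrow> l1 (F i)) \<Longrightarrow> l1 (\<Sum>i\<in>I. F i)"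
  by (induction I rule: infinite_finite_induct) (auto intro: l1_add simp: l1_def[of 0])

lemma norm1_sum: "(\<And>i. i \<in> I \<Longrightarrow> l1 (F i)) \<Longrightarrow> norm1 (\<Sum>i\<in>I. F i) \<le> (\<Sum>i\<in>I. norm1 (F i))"
proof (induction I rule: infinite_finite_induct)
  case (insert x I)
  then show ?case
    using norm1_add[of "F x" "\<Sum>i\<in>I. F i"] l1_sum[of I F] by force
qed (auto simp: norm1_def)

lemma l1_1: "l1 1" using l1_X_power[of 0] by simp

lemma l1_X: "l1 fps_X" using l1_X_power[of 1] by simp

lemma l1_diff: "l1 F \<Longrightarrow> l1 G \<Longrightarrow> l1 (F - G)"
  using l1_add[of F "fps_const (-1) * G"] l1_const_mult[of G "-1"]
  by (simp add: l1_def)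

lemma l1_power: "l1 F \<Longrightarrow> l1 (F ^ k)"
  by (induction k) (auto intro: l1_mult l1_1)

lemma l1_prod: "(\<And>i. i \<in> I \<Longrightarrow> l1 (F i)) \<Longrightarrow> l1 (\<Prod>i\<in>I. F i)"
  by (induction I rule: infinite_finite_induct) (auto intro: l1_mult l1_1)

subsection \<open>Smoothing by independent summands\<close>

definition fair :: "real fps" where
  "fair = fps_const (1/2) * (1 + fps_X)"

abbreviation interval_fps :: "nat \<Rightarrow> real fps" where
  "interval_fps m \<equiv> (\<Sum>i<m. fps_X ^ i)"

lemma l1_fair: "l1 fair"
  unfolding fair_def by (intro l1_const_mult l1_add l1_1 l1_X)

lemma fps_const_2: "fps_const 2 = (2 :: real fps)"
  using fps_numeral_fps_const[of "Num.Bit0 Num.One"] by simp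

lemma fps_const_4: "fps_const 4 = (4 :: real fps)"
  using fps_numeral_fps_const[of "Num.Bit0 (Num.Bit0 Num.One)"] by simp

lemma fair_double: "2 * fair = 1 + fps_X"
proof -
  have "2 * fair = fps_const 2 * fps_const (1/2) * (1 + fps_X)"
    by (simp only: fair_def fps_const_2 mult.assoc)
  then show ?thesis by simp
qed

text \<open>Since \<open>4 * b\<^sup>2 = 1 + 2 * x + x\<^sup>2\<close>, its even shifts overlap at
  even exponents and cover everything twice except the two end points, which are added
  separately.\<close>

lemma interval_sum_odd:
  fixes b x :: "'a::comm_ring_1"
  assumes "2 * b = 1 + x"
  shows "2 * (\<Sum>i<2 * j + 1. x ^ i) = 1 + x ^ (2 * j) + 4 * (b\<^sup>2 * (\<Sum>i<j. x ^ (2 * i)))"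
proof (induction j)
  case (Suc j)
  have x: "x = 2 * b - 1" using assms by (simp add: algebra_simps)
  have *: "2 * x + 2 * x\<^sup>2 = x\<^sup>2 - 1 + 4 * b\<^sup>2"
    unfolding x by (simp add: algebra_simps power2_eq_square)
  let ?y = "x ^ (2 * j)"
  have "2 * (\<Sum>i<2 * Suc j + 1. x ^ i) = 2 * (\<Sum>i<2 * j + 1. x ^ i) + (2 * x + 2 * x\<^sup>2) * ?y"
    by (simp add: algebra_simps eval_nat_numeral)
  also have "\<dots> = (1 + ?y + 4 * (b\<^sup>2 * (\<Sum>i<j. x ^ (2 * i)))) + (x\<^sup>2 - 1 + 4 * b\<^sup>2) * ?y"
    unfolding Suc * by simp
  also have "\<dots> = 1 + x\<^sup>2 * ?y + 4 * (b\<^sup>2 * ((\<Sum>i<j. x ^ (2 * i)) + ?y))"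
    by (simp add: algebra_simps)
  also have "\<dots> = 1 + x ^ (2 * Suc j) + 4 * (b\<^sup>2 * (\<Sum>i<Suc j. x ^ (2 * i)))"
    by (simp add: power2_eq_square mult.assoc)
  finally show ?case .
qed auto

text \<open>For even length the tile is \<open>4 * b ^ 3\<close>, with coefficients 1/2, 3/2, 3/2,
  1/2. Its even shifts add up to 2 in the interior; one coin and one point at each end repair the
  boundary.\<close>

lemma interval_sum_even:
  fixes b x :: "'a::comm_ring_1"
  assumes "2 * b = 1 + x"
  shows "2 * (\<Sum>i<2 * j + 2. x ^ i) = b + b * x ^ (2 * j) + 1 + x ^ (2 * j + 1)
     + 4 * (b ^ 3 * (\<Sum>i<j. x ^ (2 * i)))"
proof (induction j)
  case 0
  then show ?case using assms by (simp add: algebra_simps numeral_2_eq_2)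
next
  case (Suc j)
  have x: "x = 2 * b - 1" using assms by (simp add: algebra_simps)
  have *: "2 * x\<^sup>2 + 2 * x ^ 3 = b * x\<^sup>2 - b + x ^ 3 - x + 4 * b ^ 3"
    unfolding x by (simp add: algebra_simps power2_eq_square power3_eq_cube)
  let ?y = "x ^ (2 * j)"
  have "2 * (\<Sum>i<2 * Suc j + 2. x ^ i) = 2 * (\<Sum>i<2 * j + 2. x ^ i) + (2 * x\<^sup>2 + 2 * x ^ 3) * ?y"
    by (simp add: algebra_simps eval_nat_numeral)
  also have "\<dots> = (b + b * ?y + 1 + x * ?y + 4 * (b ^ 3 * (\<Sum>i<j. x ^ (2 * i))))
      + (b * x\<^sup>2 - b + x ^ 3 - x + 4 * b ^ 3) * ?y"
    unfolding Suc * by simp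
  also have "\<dots> = b + b * (x\<^sup>2 * ?y) + 1 + x ^ 3 * ?y + 4 * (b ^ 3 * ((\<Sum>i<j. x ^ (2 * i)) + ?y))"
    by (simp add: algebra_simps)
  also have "\<dots> = b + b * x ^ (2 * Suc j) + 1 + x ^ (2 * Suc j + 1)
     + 4 * (b ^ 3 * (\<Sum>i<Suc j. x ^ (2 * i)))"
    by (simp add: power2_eq_square power3_eq_cube mult.assoc)
  finally show ?case .
qed

text \<open>Intervals are built from singletons, fair coins and their convolution powers, so that a
  bound on the norm after smoothing by coins bounds the norm after smoothing by an interval.\<close>

lemma norm1_interval_mult_le:
  fixes V :: "real fps"
  assumes V: "l1 V"
    and s: "norm1 V \<le> s0" "norm1 (fair * V) \<le> s1" "norm1 (fair\<^sup>2 * V) \<le> s2" "norm1 (fair ^ 3 * V) \<le> s3"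
    and c: "2 * s1 \<le> s0 + s2" "s1 + 2 * s3 \<le> 3 * s2" "s3 \<le> s2"
    and m: "m > 0"
  shows "norm1 (interval_fps m * V) \<le> s0 + (real m - 1) * s2"
proof -
  have l1_run: "l1 (interval_fps k * V)" for k
    by (intro l1_mult l1_sum V l1_X_power)
  have dbl: "norm1 (2 * (interval_fps k * V)) = 2 * norm1 (interval_fps k * V)" for k
    using norm1_const_mult[OF l1_run, of 2 k] by (simp add: fps_const_2)
  have l1_4: "l1 (4 * F)" and norm1_4: "norm1 (4 * F) = 4 * norm1 F" if "l1 F" for F
    using l1_const_mult[OF that, of 4] norm1_const_mult[OF that, of 4]
    by (simp_all add: fps_const_4)
  have E: "norm1 (B * (\<Sum>i<j. fps_X ^ (2 * i)) * V) \<le> real j * t"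
    if B: "l1 B" "norm1 (B * V) \<le> t" for B t and j :: nat
  proof -
    have "B * (\<Sum>i<j. fps_X ^ (2 * i)) * V = (\<Sum>i<j. fps_X ^ (2 * i) * (B * V))"
      by (simp add: sum_distrib_left sum_distrib_right mult_ac)
    also have "norm1 \<dots> \<le> (\<Sum>i<j. norm1 (fps_X ^ (2 * i) * (B * V)))"
      by (rule norm1_sum) (intro l1_X_power_mult l1_mult B V)
    also have "\<dots> \<le> (\<Sum>i<j. t)"
      by (intro sum_mono order.trans[OF norm1_X_power_mult] l1_mult B V)
    finally show ?thesis by simp
  qed
  have l1_E: "l1 (B * (\<Sum>i<j. fps_X ^ (2 * i)) * V)" if "l1 B" for B and j :: nat
    by (intro l1_mult that l1_sum l1_X_power V)
  have X: "norm1 (fps_X ^ k * V) \<le> s0" for k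
    using norm1_X_power_mult[OF V, of k] s(1) by linarith
  have FX: "norm1 (fps_X ^ k * (fair * V)) \<le> s1" for k
    by (rule order.trans[OF norm1_X_power_mult]) (intro l1_mult l1_fair V s(2))+
  show ?thesis
  proof (cases "odd m")
    case True
    then obtain j where j: "m = 2 * j + 1" by (auto elim: oddE)
    have "2 * (interval_fps m * V) = (2 * interval_fps m) * V" by (simp only: mult.assoc)
    also have "\<dots> = V + fps_X ^ (2 * j) * V + 4 * (fair\<^sup>2 * (\<Sum>i<j. fps_X ^ (2 * i)) * V)"
      unfolding j interval_sum_odd[OF fair_double] by (simp only: distrib_right mult_1 mult.assoc)
    finally have "2 * norm1 (interval_fps m * V) =
        norm1 (V + fps_X ^ (2 * j) * V + 4 * (fair\<^sup>2 * (\<Sum>i<j. fps_X ^ (2 * i)) * V))"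
      by (simp only: dbl[symmetric])
    also have "\<dots> \<le> norm1 V + norm1 (fps_X ^ (2 * j) * V)
        + 4 * norm1 (fair\<^sup>2 * (\<Sum>i<j. fps_X ^ (2 * i)) * V)"
      by (subst norm1_4[symmetric] | rule order.trans[OF norm1_add] add_mono order.refl
          l1_add l1_4 l1_E l1_power l1_fair V l1_X_power_mult)+
    also have "\<dots> \<le> s0 + s0 + 4 * (real j * s2)"
      by (intro add_mono s X mult_left_mono E l1_power l1_fair) simp
    finally show ?thesis using j by simp
  next
    case False
    with m obtain i where i: "m = 2 * i" "i > 0" by (auto elim: evenE)
    define j where "j = i - 1"
    have j: "m = 2 * j + 2" using i by (simp add: j_def)
    show ?thesis
    proof (cases "j = 0")
      case True
      have eq: "interval_fps m * V = fps_const 2 * (fair * V)"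
        using fair_double True j by (simp add: fps_const_2 mult.assoc[symmetric] numeral_2_eq_2)
      have "norm1 (interval_fps m * V) \<le> 2 * s1"
        unfolding eq using norm1_const_mult[of "fair * V" 2] s(2) l1_mult[OF l1_fair V] by simp
      then show ?thesis using c True j by simp
    next
      case False
      have "2 * (interval_fps m * V) = (2 * interval_fps m) * V" by (simp only: mult.assoc)
      also have "\<dots> = fair * V + fps_X ^ (2 * j) * (fair * V) + V + fps_X ^ (2 * j + 1) * V
          + 4 * (fair ^ 3 * (\<Sum>i<j. fps_X ^ (2 * i)) * V)"
        unfolding j interval_sum_even[OF fair_double] by (simp add: algebra_simps)
      finally have "2 * norm1 (interval_fps m * V) =
          norm1 (fair * V + fps_X ^ (2 * j) * (fair * V) + V + fps_X ^ (2 * j + 1) * V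
          + 4 * (fair ^ 3 * (\<Sum>i<j. fps_X ^ (2 * i)) * V))"
        by (simp only: dbl[symmetric])
      also have "\<dots> \<le> norm1 (fair * V) + norm1 (fps_X ^ (2 * j) * (fair * V)) + norm1 V
          + norm1 (fps_X ^ (2 * j + 1) * V)
          + 4 * norm1 (fair ^ 3 * (\<Sum>i<j. fps_X ^ (2 * i)) * V)"
        by (subst norm1_4[symmetric] | rule order.trans[OF norm1_add] add_mono order.refl
            l1_add l1_4 l1_E l1_power l1_fair V l1_X_power_mult l1_mult)+
      also have "\<dots> \<le> s1 + s1 + s0 + s0 + 4 * (real j * s3)"
        by (intro add_mono s X FX mult_left_mono E l1_power l1_fair) simp
      also have "\<dots> = 2 * s0 + 2 * (s1 + 2 * s3) + 4 * ((real j - 1) * s3)"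
        by (simp add: algebra_simps)
      \<comment> \<open>One of the \<open>j\<close> tiles is set aside to be paired with the two end
        coins, which is why \<open>j = 0\<close> is treated separately.\<close>
      also have "\<dots> \<le> 2 * s0 + 2 * (3 * s2) + 4 * ((real j - 1) * s2)"
        using False by (intro add_mono mult_left_mono c) auto
      finally show ?thesis using j by (simp add: algebra_simps)
    qed
  qed
qed


section \<open>Decomposition of a law into uniform laws on intervals\<close>

text \<open>From the leftmost maximal run of positive entries a constant layer of the run's minimal
  height is peeled off. A layer of height \<open>c\<close> and length \<open>m\<close> has mass
  \<open>c * m\<close> and overlap \<open>c * (m - 1)\<close>, so the interval bound is linear in
  these two quantities and adds up over layers. Each layer annihilates an entry, hence the induction
  on the size of the support.\<close>

lemma norm1_mult_le_overlap_finite: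
  fixes F V :: "real fps"
  assumes V: "l1 V"
    and run: "\<And>m. m > 0 \<Longrightarrow> norm1 (interval_fps m * V) \<le> s0 + (real m - 1) * s2"
  shows "(\<And>k. 0 \<le> fps_nth F k) \<Longrightarrow> (\<And>k. N \<le> k \<Longrightarrow> fps_nth F k = 0) \<Longrightarrow> l1 F \<and>
    norm1 (F * V) \<le> s0 * (\<Sum>k<N. fps_nth F k)
      - (s0 - s2) * (\<Sum>k<N. min (fps_nth F k) (fps_nth F (Suc k)))"
proof (induction "card {k. fps_nth F k \<noteq> 0}" arbitrary: F rule: less_induct)
  case less
  define S where "S = {k. fps_nth F k \<noteq> 0}"
  have SN: "S \<subseteq> {..<N}" using less(3) unfolding S_def by (auto simp: not_le[symmetric])
  then have finS: "finite S" by (rule finite_subset) simp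
  show ?case
  proof (cases "S = {}")
    case True
    then have "F = 0" unfolding S_def by (intro fps_ext) auto
    then show ?thesis by (simp add: norm1_def l1_def)
  next
    case False
    define i where "i = Min S"
    have iS: "i \<in> S" using False finS unfolding i_def by simp
    have below: "fps_nth F k = 0" if "k < i" for k
      using that Min_le[OF finS, of k] unfolding i_def S_def by auto
    define m where "m = (LEAST m. fps_nth F (i + m) = 0)"
    have "fps_nth F (i + N) = 0" using less(3) by simp
    then have m0: "fps_nth F (i + m) = 0" unfolding m_def by (rule LeastI)
    have mpos: "m > 0" using m0 iS unfolding S_def by (cases m) auto
    have ne: "fps_nth F k \<noteq> 0" if "i \<le> k" "k < i + m" for k
      using not_less_Least[of "k - i" "\<lambda>m. fps_nth F (i + m) = 0"] that unfolding m_def[symmetric] by auto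
    have mN: "i + m \<le> N"
      using ne[of N] less(3)[of N] ne[of "i + m - 1"] less(3)[of "i + m - 1"] mpos by force
    define c where "c = Min (fps_nth F ` {i..<i + m})"
    have cle: "c \<le> fps_nth F k" if "i \<le> k" "k < i + m" for k
      unfolding c_def using that by (intro Min_le) auto
    have "c \<in> fps_nth F ` {i..<i + m}" unfolding c_def using mpos by (intro Min_in) auto
    then obtain k0 where k0: "i \<le> k0" "k0 < i + m" "fps_nth F k0 = c" by auto
    have cpos: "c > 0" using ne[OF k0(1,2)] less(2)[of k0] k0(3) by linarith
    define R where "R = fps_const c * (fps_X ^ i * interval_fps m)"
    define G where "G = F - R"
    have int_nth: "fps_nth (interval_fps m) k = (if k < m then 1 else 0)" for k
      by (simp add: fps_sum_nth fps_X_power_nth)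
    have R_nth: "fps_nth R k = (if i \<le> k \<and> k < i + m then c else 0)" for k
      by (auto simp: R_def fps_X_power_mult_nth int_nth)
    have G_nth: "fps_nth G k = fps_nth F k - (if i \<le> k \<and> k < i + m then c else 0)" for k
      by (simp add: G_def R_nth)
    have Gpos: "0 \<le> fps_nth G k" for k
      using cle[of k] less(2)[of k] by (auto simp: G_nth)
    have GN: "fps_nth G k = 0" if "N \<le> k" for k
      using less(3)[OF that] that mN by (auto simp: G_nth)
    have "{k. fps_nth G k \<noteq> 0} \<subset> S"
    proof
      show "{k. fps_nth G k \<noteq> 0} \<subseteq> S" using ne by (auto simp: G_nth S_def split: if_splits)
      show "{k. fps_nth G k \<noteq> 0} \<noteq> S" using k0 ne[of k0] by (auto simp: G_nth S_def)
    qed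
    then have "card {k. fps_nth G k \<noteq> 0} < card {k. fps_nth F k \<noteq> 0}"
      using psubset_card_mono[OF finS] unfolding S_def by blast
    then have IH: "l1 G" "norm1 (G * V) \<le> s0 * (\<Sum>k<N. fps_nth G k)
      - (s0 - s2) * (\<Sum>k<N. min (fps_nth G k) (fps_nth G (Suc k)))"
      using less(1)[of G] Gpos GN by auto
    have l1R: "l1 R" unfolding R_def by (intro l1_const_mult l1_mult l1_X_power l1_sum)
    have F: "F = G + R" by (simp add: G_def)
    have "(\<Sum>k<N. fps_nth R k) = (\<Sum>k\<in>{i..<i + m}. c)"
      using mN by (intro sum.mono_neutral_cong_right) (auto simp: R_nth)
    then have massF: "(\<Sum>k<N. fps_nth F k) = (\<Sum>k<N. fps_nth G k) + c * real m"
      by (simp add: F sum.distrib)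
    \<comment> \<open>Inside the run both neighbours drop by \<open>c\<close>. At its two edges one
      neighbour is 0 before and after, because the run is maximal; this makes the minima
      additive.\<close>
    have "min (fps_nth F k) (fps_nth F (Suc k)) = min (fps_nth G k) (fps_nth G (Suc k))
        + (if i \<le> k \<and> Suc k < i + m then c else 0)" for k
    proof (cases "k < i")
      case True
      then show ?thesis using below[OF True] Gpos[of "Suc k"] less(2)[of "Suc k"]
        by (simp add: G_nth min_def)
    next
      case False
      show ?thesis
      proof (cases "Suc k = i + m")
        case True
        then have "fps_nth F (Suc k) = 0" "fps_nth G (Suc k) = 0" using m0 by (auto simp: G_nth)
        then show ?thesis using Gpos[of k] less(2)[of k] True by (simp add: min_def)
      next
        case f: False
        with False show ?thesis by (auto simp: G_nth min_def)
      qed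
    qed
    then have "(\<Sum>k<N. min (fps_nth F k) (fps_nth F (Suc k))) =
        (\<Sum>k<N. min (fps_nth G k) (fps_nth G (Suc k))) + (\<Sum>k<N. (if i \<le> k \<and> Suc k < i + m then c else 0))"
      by (simp add: sum.distrib)
    also have "(\<Sum>k<N. (if i \<le> k \<and> Suc k < i + m then c else 0)) = (\<Sum>k\<in>{i..<i + m - 1}. c)"
      using mN by (intro sum.mono_neutral_cong_right) auto
    finally have ovF: "(\<Sum>k<N. min (fps_nth F k) (fps_nth F (Suc k))) =
        (\<Sum>k<N. min (fps_nth G k) (fps_nth G (Suc k))) + c * (real m - 1)"
      using mpos by (simp add: of_nat_diff algebra_simps)
    have "norm1 (R * V) = c * norm1 (fps_X ^ i * (interval_fps m * V))"
      unfolding R_def mult.assoc using cpos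
      by (subst norm1_const_mult) (auto intro!: l1_mult l1_X_power l1_sum V)
    also have "\<dots> \<le> c * norm1 (interval_fps m * V)"
      using cpos by (intro mult_left_mono norm1_X_power_mult l1_mult l1_sum l1_X_power V) auto
    also have "\<dots> \<le> c * (s0 + (real m - 1) * s2)"
      using cpos by (intro mult_left_mono run mpos) auto
    finally have RV: "norm1 (R * V) \<le> c * (s0 + (real m - 1) * s2)" .
    have "norm1 (F * V) \<le> norm1 (G * V) + norm1 (R * V)"
      unfolding F distrib_right by (intro norm1_add l1_mult IH l1R V)
    then show ?thesis
      using RV IH l1R l1_add[OF IH(1) l1R] unfolding massF ovF F[symmetric]
      by (simp add: algebra_simps)
  qed
qed

text \<open>Truncate, apply the finite case, and pass to the limit; the discarded mass is multiplied
  by \<open>norm1 V\<close> and tends to 0.\<close>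

lemma norm1_mult_le_overlap:
  fixes F V :: "real fps"
  assumes V: "l1 V"
    and run: "\<And>m. m > 0 \<Longrightarrow> norm1 (interval_fps m * V) \<le> s0 + (real m - 1) * s2"
    and F: "\<And>k. 0 \<le> fps_nth F k" "fps_nth F sums t"
    and o: "(\<lambda>k. min (fps_nth F k) (fps_nth F (Suc k))) sums \<theta>"
  shows "norm1 (F * V) \<le> s0 * t - (s0 - s2) * \<theta>"
proof (rule LIMSEQ_le_const)
  have F1: "l1 F" using F by (simp add: l1_def sums_iff)
  have nF: "norm1 F = t" using F by (simp add: norm1_def sums_iff)
  let ?B = "\<lambda>N. s0 * (\<Sum>k<Suc N. fps_nth F k)
      - (s0 - s2) * (\<Sum>k<N. min (fps_nth F k) (fps_nth F (Suc k)))
      + (t - (\<Sum>k<Suc N. fps_nth F k)) * norm1 V"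
  have "?B \<longlonglongrightarrow> s0 * t - (s0 - s2) * \<theta> + (t - t) * norm1 V"
    using F(2) o unfolding sums_def
    by (intro tendsto_intros LIMSEQ_Suc[of "\<lambda>N. \<Sum>k<N. fps_nth F k"])
  then show "?B \<longlonglongrightarrow> s0 * t - (s0 - s2) * \<theta>" by simp
  show "\<exists>M. \<forall>N\<ge>M. norm1 (F * V) \<le> ?B N"
  proof (intro exI allI impI)
    fix N :: nat
    define C where "C = fps_cutoff (Suc N) F"
    have C_nth: "fps_nth C k = (if k < Suc N then fps_nth F k else 0)" for k
      by (simp add: C_def)
    have *: "l1 C \<and> norm1 (C * V) \<le> s0 * (\<Sum>k<Suc N. fps_nth C k)
      - (s0 - s2) * (\<Sum>k<Suc N. min (fps_nth C k) (fps_nth C (Suc k)))"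
      by (rule norm1_mult_le_overlap_finite[OF V run]) (use F in \<open>auto simp: C_nth\<close>)
    \<comment> \<open>The cutoff keeps the entry at \<open>N\<close> but not its right neighbour, so
      the last minimum is 0 and the overlap sum ends one index earlier than the mass.\<close>
    have o': "(\<Sum>k<Suc N. min (fps_nth C k) (fps_nth C (Suc k)))
        = (\<Sum>k<N. min (fps_nth F k) (fps_nth F (Suc k)))"
      using F(1) by (simp add: C_nth)
    have m': "(\<Sum>k<Suc N. fps_nth C k) = (\<Sum>k<Suc N. fps_nth F k)"
      by (intro sum.cong) (auto simp: C_nth)
    have 1: "l1 (F - C)" using F1 * by (intro l1_diff) auto
    have "(\<lambda>k. \<bar>fps_nth C k\<bar>) sums (\<Sum>k<Suc N. \<bar>fps_nth C k\<bar>)"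
      by (rule sums_finite) (auto simp: C_nth)
    moreover have "(\<Sum>k<Suc N. \<bar>fps_nth C k\<bar>) = (\<Sum>k<Suc N. fps_nth F k)"
      by (intro sum.cong) (use F in \<open>auto simp: C_nth\<close>)
    ultimately have "(\<lambda>k. fps_nth F k - \<bar>fps_nth C k\<bar>) sums (t - (\<Sum>k<Suc N. fps_nth F k))"
      using sums_diff[OF F(2)] by metis
    moreover have "(\<lambda>k. fps_nth F k - \<bar>fps_nth C k\<bar>) = (\<lambda>k. \<bar>fps_nth (F - C) k\<bar>)"
      using F(1) by (auto simp: C_nth)
    ultimately have 2: "norm1 (F - C) = t - (\<Sum>k<Suc N. fps_nth F k)"
      by (simp add: norm1_def sums_iff)
    have "norm1 (F * V) = norm1 (C * V + (F - C) * V)" by (simp add: algebra_simps)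
    also have "\<dots> \<le> norm1 (C * V) + norm1 ((F - C) * V)"
      using * 1 V by (intro norm1_add l1_mult) auto
    also have "\<dots> \<le> norm1 (C * V) + (t - (\<Sum>k<Suc N. fps_nth F k)) * norm1 V"
      using norm1_mult[OF 1 V] 2 by simp
    finally show "norm1 (F * V) \<le> ?B N" using * unfolding o' m' by simp
  qed
qed


section \<open>The central binomial estimate for fair coins\<close>

text \<open>The factor \<open>3 * j + 1\<close> is what lets the induction close: the step needs
  \<open>(2 * j + 1)\<^sup>2 * (3 * j + 4) \<le> 4 * (j + 1)\<^sup>2 * (3 * j + 1)\<close>, and the
  two sides differ by exactly \<open>j\<close>.\<close>

lemma central_binomial_sq_le: "(real ((2 * j) choose j))\<^sup>2 * (3 * real j + 1) \<le> 16 ^ j"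
proof (induction j)
  case (Suc j)
  have "Suc j * ((2 * Suc j) choose (Suc j)) = 2 * (2 * j + 1) * ((2 * j) choose j)"
  proof -
    have 1: "Suc j * (Suc (2 * j) choose Suc j) = Suc (2 * j) * (2 * j choose j)"
      by (rule Suc_times_binomial)
    have "(2 * Suc j) choose (Suc j) = (Suc (2 * j) choose j) + (Suc (2 * j) choose Suc j)"
      by simp
    moreover have "Suc (2 * j) choose j = Suc (2 * j) choose Suc j"
      using binomial_symmetric[of j "Suc (2 * j)"] by (simp add: numeral_2_eq_2)
    ultimately have "(2 * Suc j) choose (Suc j) = 2 * (Suc (2 * j) choose Suc j)" by simp
    then have "Suc j * ((2 * Suc j) choose (Suc j)) = 2 * (Suc j * (Suc (2 * j) choose Suc j))"
      by (metis mult.left_commute)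
    then show ?thesis unfolding 1 by simp
  qed
  then have "real (Suc j * ((2 * Suc j) choose (Suc j))) = real (2 * (2 * j + 1) * ((2 * j) choose j))"
    by (simp only:)
  then have e: "(real j + 1) * real ((2 * Suc j) choose (Suc j)) = 2 * (2 * real j + 1) * real ((2 * j) choose j)"
    by (simp only: of_nat_mult of_nat_add of_nat_Suc) (simp add: algebra_simps)
  let ?c = "real ((2 * j) choose j)" and ?d = "real ((2 * Suc j) choose (Suc j))"
  have "(real j + 1)\<^sup>2 * (?d\<^sup>2 * (3 * real (Suc j) + 1)) = ((real j + 1) * ?d)\<^sup>2 * (3 * real j + 4)"
    by (simp only: power_mult_distrib) simp
  also have "\<dots> = ?c\<^sup>2 * (4 * ((2 * real j + 1)\<^sup>2 * (3 * real j + 4)))"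
    unfolding e by (simp add: power2_eq_square algebra_simps)
  also have "\<dots> \<le> ?c\<^sup>2 * (4 * (4 * (real j + 1)\<^sup>2 * (3 * real j + 1)))"
    by (intro mult_left_mono) (auto simp: power2_eq_square algebra_simps)
  also have "\<dots> = 16 * (real j + 1)\<^sup>2 * (?c\<^sup>2 * (3 * real j + 1))"
    by simp
  also have "\<dots> \<le> 16 * (real j + 1)\<^sup>2 * 16 ^ j"
    using Suc by (intro mult_left_mono) auto
  also have "\<dots> = (real j + 1)\<^sup>2 * 16 ^ Suc j" by simp
  finally show ?case by (rule mult_left_le_imp_le) simp
qed simp

lemma central_binomial_le: "real ((2 * j) choose j) / 4 ^ j \<le> 1 / sqrt (3 * real j + 1)"
proof -
  have "real ((2 * j) choose j) * sqrt (3 * real j + 1) = sqrt ((real ((2 * j) choose j))\<^sup>2 * (3 * real j + 1))"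
    by (simp add: real_sqrt_mult)
  also have "\<dots> \<le> sqrt ((4 ^ j)\<^sup>2)"
    using central_binomial_sq_le[of j] by (simp add: power2_eq_square power_mult_distrib[symmetric])
  finally have "real ((2 * j) choose j) * sqrt (3 * real j + 1) \<le> 4 ^ j"
    by simp
  moreover have "sqrt (3 * real j + 1) > 0" by (simp add: add_nonneg_pos)
  ultimately show ?thesis by (simp add: field_simps)
qed

lemma middle_binomial_le: "real (k choose (k div 2)) / 2 ^ k \<le> 1 / sqrt (3 / 2 * real k + 1)"
proof (cases "even k")
  case True
  then obtain j where "k = 2 * j" by blast
  then show ?thesis using central_binomial_le[of j] by (simp add: power_mult)
next
  case False
  then obtain j where k: "k = 2 * j + 1" by (auto elim: oddE)
  have "(2 * Suc j) choose (Suc j) = (Suc (2 * j) choose j) + (Suc (2 * j) choose Suc j)"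
    by simp
  moreover have "Suc (2 * j) choose j = Suc (2 * j) choose Suc j"
    using binomial_symmetric[of j "Suc (2 * j)"] by (simp add: numeral_2_eq_2)
  ultimately have "(2 * Suc j) choose (Suc j) = 2 * (Suc (2 * j) choose j)" by simp
  \<comment> \<open>The middle probability for an odd number of coins equals that for one coin
    more.\<close>
  then have "real (k choose (k div 2)) / 2 ^ k = real ((2 * Suc j) choose (Suc j)) / 4 ^ Suc j"
    by (simp add: k power_mult)
  also have "\<dots> \<le> 1 / sqrt (3 * real (Suc j) + 1)" by (rule central_binomial_le)
  also have "\<dots> \<le> 1 / sqrt (3 / 2 * real k + 1)"
    by (intro divide_left_mono) (auto simp: k add_nonneg_pos)
  finally show ?thesis .
qed

lemma fair_power_nth: "fps_nth (fair ^ k) i = real (k choose i) / 2 ^ k"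
proof -
  have "fair ^ k = fps_const ((1/2) ^ k) * (1 + fps_X) ^ k"
    unfolding fair_def power_mult_distrib fps_const_power ..
  moreover have "fps_nth ((1 + fps_X :: real fps) ^ k) i = real (k choose i)"
  proof -
    have "(1 + fps_X :: real fps) ^ k = (\<Sum>j\<le>k. of_nat (k choose j) * fps_X ^ j)"
      using binomial_ring[of "fps_X :: real fps" 1 k] by (simp add: add.commute)
    also have "\<dots> = (\<Sum>j\<le>k. fps_const (real (k choose j)) * fps_X ^ j)"
      by (simp add: fps_of_nat)
    also have "fps_nth \<dots> i = (\<Sum>j\<le>k. if i = j then real (k choose j) else 0)"
      by (subst fps_sum_nth) (intro sum.cong, auto simp: fps_X_power_nth)
    also have "\<dots> = real (k choose i)" by (auto simp: binomial_eq_0)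
    finally show ?thesis .
  qed
  ultimately show ?thesis by (simp add: power_divide)
qed

text \<open>Binomial coefficients are unimodal, so their total variation is twice the maximum: one
  climb and one descent, both telescoping.\<close>

lemma norm1_fair_power_diff: "norm1 (fair ^ k * (1 - fps_X)) = 2 * (real (k choose (k div 2)) / 2 ^ k)"
proof -
  define f where "f i = real (k choose i) / 2 ^ k" for i
  define j where "j = k div 2"
  have nth0: "fps_nth (fair ^ k * (1 - fps_X)) 0 = f 0"
    by (simp add: algebra_simps fair_power_nth f_def)
  have nthS: "fps_nth (fair ^ k * (1 - fps_X)) (Suc i) = f (Suc i) - f i" for i
    by (simp add: algebra_simps fair_power_nth f_def)
  have f0: "f i = 0" if "i > k" for i using that by (simp add: f_def)
  have up: "f i \<le> f (Suc i)" if "i < j" for i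
    using binomial_mono[of i "Suc i" k] that by (simp add: f_def j_def divide_right_mono)
  have down: "f (Suc i) \<le> f i" if "j \<le> i" for i
  proof (cases "Suc i \<le> k")
    case True
    then show ?thesis using binomial_antimono[of i "Suc i" k] that
      by (simp add: f_def j_def divide_right_mono)
  qed (simp add: f0, simp add: f_def)
  have "(\<lambda>i. \<bar>f (Suc i) - f i\<bar>) sums (\<Sum>i<Suc k. \<bar>f (Suc i) - f i\<bar>)"
    by (rule sums_finite) (auto simp: f0)
  also have "(\<Sum>i<Suc k. \<bar>f (Suc i) - f i\<bar>) = (\<Sum>i<j. \<bar>f (Suc i) - f i\<bar>) + (\<Sum>i=j..<Suc k. \<bar>f (Suc i) - f i\<bar>)"
    using sum.atLeastLessThan_concat[of 0 j "Suc k" "\<lambda>i. \<bar>f (Suc i) - f i\<bar>"]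
    by (simp add: j_def atLeast0LessThan)
  also have "(\<Sum>i<j. \<bar>f (Suc i) - f i\<bar>) = (\<Sum>i<j. f (Suc i) - f i)"
    using up by (intro sum.cong) auto
  also have "\<dots> = f j - f 0" by (rule sum_lessThan_telescope)
  also have "(\<Sum>i=j..<Suc k. \<bar>f (Suc i) - f i\<bar>) = (\<Sum>i=j..<Suc k. - (f (Suc i) - f i))"
    using down by (intro sum.cong) auto
  also have "\<dots> = f j - f (Suc k)"
    unfolding sum_negf by (subst sum_Suc_diff') (auto simp: j_def)
  finally have "(\<lambda>i. \<bar>fps_nth (fair ^ k * (1 - fps_X)) (Suc i)\<bar>) sums (2 * f j - f 0)"
    unfolding nthS by (simp add: f0)
  then have "(\<lambda>i. \<bar>fps_nth (fair ^ k * (1 - fps_X)) i\<bar>) sums (2 * f j - f 0 + \<bar>f 0\<bar>)"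
    using nth0 by (subst (asm) sums_Suc_iff) simp
  then show ?thesis by (simp add: norm1_def sums_iff f_def j_def)
qed

lemma norm1_fair_power_diff_le: "norm1 (fair ^ k * (1 - fps_X)) \<le> 2 / sqrt (3 / 2 * real k + 1)"
  using middle_binomial_le[of k] by (simp add: norm1_fair_power_diff)

section \<open>Inequalities for inverse square roots\<close>

lemma inverse_sqrt_le: "1 / sqrt x \<le> (r::real)" if "x > 0" "r \<ge> 0" "1 \<le> r\<^sup>2 * x"
proof -
  have "1 \<le> sqrt (r\<^sup>2 * x)" using that by simp
  then have "1 \<le> r * sqrt x" using that by (simp add: real_sqrt_mult)
  then show ?thesis using that by (simp add: field_simps)
qed

lemma inverse_sqrt_ge: "(r::real) \<le> 1 / sqrt x" if "x > 0" "r \<ge> 0" "r\<^sup>2 * x \<le> 1"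
proof -
  have "sqrt (r\<^sup>2 * x) \<le> 1" using that by simp
  then have "r * sqrt x \<le> 1" using that by (simp add: real_sqrt_mult)
  then show ?thesis using that by (simp add: field_simps)
qed

text \<open>These are conditions on \<open>s0\<close> to \<open>s3\<close> in
  \<open>norm1_interval_mult_le\<close> for the profile \<open>2 / sqrt (A + 3/2 * j)\<close>. The
  first is midpoint convexity, obtained from tangents at the midpoint. In the second the linear
  Taylor terms leave a surplus \<open>u / 2\<close>, which has to absorb the quadratic ones;
  \<open>A \<ge> 1\<close> keeps \<open>u\<close> below 3/8.\<close>

lemma inverse_sqrt_interpolation:
  fixes A :: real
  assumes "A \<ge> 1"
  shows "2 * (1 / sqrt (A + 3/2)) \<le> 1 / sqrt A + 1 / sqrt (A + 3)" (is ?th1)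
    and "1 / sqrt (A + 3/2) + 2 * (1 / sqrt (A + 9/2)) \<le> 3 * (1 / sqrt (A + 3))" (is ?th2)
proof -
  have sc: "1 / sqrt (y * c) = 1 / sqrt y * (1 / sqrt c)" for y c :: real
    by (simp add: real_sqrt_mult)
  define y where "y = A + 3/2"
  define u where "u = 3/2 / y"
  have y: "y \<ge> 5/2" "y > 0" using assms by (auto simp: y_def)
  have u: "0 < u" "u \<le> 3/5" using y by (auto simp: u_def field_simps)
  have e: "A = y * (1 - u)" "A + 3 = y * (1 + u)" using y by (auto simp: u_def y_def field_simps)
  have 1: "1 + u / 2 \<le> 1 / sqrt (1 - u)"
  proof (rule inverse_sqrt_ge)
    have "(1 + u / 2)\<^sup>2 * (1 - u) = 1 - u\<^sup>2 * (3/4 + u / 4)"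
      by (simp add: power2_eq_square field_simps)
    then show "(1 + u / 2)\<^sup>2 * (1 - u) \<le> 1" using u by simp
  qed (use u in auto)
  have 2: "1 - u / 2 \<le> 1 / sqrt (1 + u)"
  proof (rule inverse_sqrt_ge)
    have "(1 - u / 2)\<^sup>2 * (1 + u) = 1 - u\<^sup>2 * (3/4 - u / 4)"
      by (simp add: power2_eq_square field_simps)
    then show "(1 - u / 2)\<^sup>2 * (1 + u) \<le> 1" using u by simp
  qed (use u in auto)
  have "1 / sqrt y * 2 \<le> 1 / sqrt y * (1 / sqrt (1 - u) + 1 / sqrt (1 + u))"
    using 1 2 y by (intro mult_left_mono) auto
  also have "\<dots> = 1 / sqrt A + 1 / sqrt (A + 3)"
    unfolding e(2) sc by (subst e(1), subst sc) (simp only: distrib_left)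
  finally show ?th1 by (simp add: y_def)
next
  have sc: "1 / sqrt (y * c) = 1 / sqrt y * (1 / sqrt c)" for y c :: real
    by (simp add: real_sqrt_mult)
  define y where "y = A + 3"
  define u where "u = 3/2 / y"
  have y: "y \<ge> 4" "y > 0" using assms by (auto simp: y_def)
  have u: "0 < u" "u \<le> 3/8" using y by (auto simp: u_def field_simps)
  have e: "A + 3/2 = y * (1 - u)" "A + 9/2 = y * (1 + u)" using y by (auto simp: u_def y_def field_simps)
  \<comment> \<open>The Taylor coefficient is 3/8. Raised to 29/50 it gives an upper bound on the
    whole range \<open>u \<le> 3/8\<close>, while \<open>(29/50 + 2 * 3/8) * 3/8\<close> still stays
    just below the surplus 1/2.\<close>
  have 1: "1 / sqrt (1 - u) \<le> 1 + u / 2 + 29 / 50 * u\<^sup>2"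
  proof (rule inverse_sqrt_le)
    have "u\<^sup>2 \<le> (3/8)\<^sup>2" "u ^ 3 \<le> (3/8) ^ 3" using u by (intro power_mono; simp)+
    then have "41/100 - 83/100 * u - 609/2500 * u\<^sup>2 - 841/2500 * u ^ 3 \<ge> 0"
      using u by (simp add: power2_eq_square power3_eq_cube)
    then have "0 \<le> u\<^sup>2 * (41/100 - 83/100 * u - 609/2500 * u\<^sup>2 - 841/2500 * u ^ 3)"
      by simp
    also have "\<dots> = (1 + u / 2 + 29 / 50 * u\<^sup>2)\<^sup>2 * (1 - u) - 1"
      by (simp add: power2_eq_square power3_eq_cube field_simps)
    finally show "1 \<le> (1 + u / 2 + 29 / 50 * u\<^sup>2)\<^sup>2 * (1 - u)" by simp
  qed (use u in auto)
  have 2: "1 / sqrt (1 + u) \<le> 1 - u / 2 + 3 / 8 * u\<^sup>2"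
  proof (rule inverse_sqrt_le)
    have "0 \<le> u ^ 3 * (5/8 - 15/64 * u + 9/64 * u\<^sup>2)" using u by (intro mult_nonneg_nonneg) auto
    also have "\<dots> = (1 - u / 2 + 3 / 8 * u\<^sup>2)\<^sup>2 * (1 + u) - 1"
      by (simp add: power2_eq_square power3_eq_cube field_simps)
    finally show "1 \<le> (1 - u / 2 + 3 / 8 * u\<^sup>2)\<^sup>2 * (1 + u)" by simp
  qed (use u in auto)
  have "u * u \<le> 3/8 * u" using u by (intro mult_right_mono) auto
  then have "1 / sqrt (1 - u) + 2 * (1 / sqrt (1 + u)) \<le> 3"
    using 1 2 u unfolding power2_eq_square by linarith
  then have "1 / sqrt y * (1 / sqrt (1 - u) + 2 * (1 / sqrt (1 + u))) \<le> 1 / sqrt y * 3"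
    using y by (intro mult_left_mono) auto
  then show ?th2 unfolding e sc by (simp add: y_def distrib_left)
qed

text \<open>The rate at which \<open>x \<mapsto> x / 3 + 3/4 * ln x\<close> grows dominates the decrease of
  \<open>1 / sqrt x\<close>, measured in units of its decrease over an interval of length 3.\<close>

lemma inverse_sqrt_step:
  fixes A B :: real
  assumes "0 < A" "A \<le> B"
  shows "1 / sqrt A - 1 / sqrt B
    \<le> (1 / sqrt A - 1 / sqrt (A + 3)) * ((B - A) / 3 + 3/4 * (ln B - ln A))"
proof -
  define D where "D = 1 / sqrt A - 1 / sqrt (A + 3)"
  define \<phi> where "\<phi> x = D * (x / 3 + 3/4 * ln x) + 1 / sqrt x" for x
  have key: "1 / 2 / (y * sqrt y) \<le> (1 / sqrt y - 1 / sqrt (y + 3)) * (1 / 3 + 3 / 4 / y)" if y: "y > 0" for y :: real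
  proof -
    define u where "u = 1 / y"
    have u: "u > 0" using y by (simp add: u_def)
    have yu: "y + 3 = y * (1 + 3 * u)" using y by (simp add: u_def field_simps)
    \<comment> \<open>The right side is the (1,1) Pade approximant of
      \<open>1 / sqrt (1 + x)\<close> at \<open>x = 3 * u\<close>. Its denominator cancels against
      \<open>1/3 + 3/4 * u = (4 + 9 * u) / 12\<close>; this is the origin of the 3/4 in front of the
      logarithm.\<close>
    have "1 / sqrt (1 + 3 * u) \<le> (4 + 3 * u) / (4 + 9 * u)"
    proof (rule inverse_sqrt_le)
      have "(4 + 9 * u)\<^sup>2 \<le> (4 + 3 * u)\<^sup>2 * (1 + 3 * u)"
      proof -
        have "(4 + 3 * u)\<^sup>2 * (1 + 3 * u) = (4 + 9 * u)\<^sup>2 + 27 * u ^ 3"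
          by (simp add: power2_eq_square power3_eq_cube algebra_simps)
        then show ?thesis using u by simp
      qed
      then show "1 \<le> ((4 + 3 * u) / (4 + 9 * u))\<^sup>2 * (1 + 3 * u)"
        using u by (simp add: power_divide)
    qed (use u in auto)
    then have "1 - 1 / sqrt (1 + 3 * u) \<ge> 1 - (4 + 3 * u) / (4 + 9 * u)" by simp
    also have "1 - (4 + 3 * u) / (4 + 9 * u) = 6 * u / (4 + 9 * u)" using u by (simp add: field_simps)
    finally have "6 * u / (4 + 9 * u) * (1 / 3 + 3 / 4 * u) \<le> (1 - 1 / sqrt (1 + 3 * u)) * (1 / 3 + 3 / 4 * u)"
      using u by (intro mult_right_mono) auto
    moreover have "6 * u / (4 + 9 * u) * (1 / 3 + 3 / 4 * u) = u / 2" using u by (simp add: field_simps)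
    ultimately have "u / 2 \<le> (1 - 1 / sqrt (1 + 3 * u)) * (1 / 3 + 3 / 4 * u)" by simp
    then have "1 / sqrt y * (u / 2) \<le> 1 / sqrt y * ((1 - 1 / sqrt (1 + 3 * u)) * (1 / 3 + 3 / 4 * u))"
      using y by (intro mult_left_mono) auto
    then show ?thesis
      unfolding yu real_sqrt_mult by (simp add: u_def algebra_simps)
  qed
  \<comment> \<open>The drop over length 3 decreases in \<open>y\<close>, so its value at the left
    end dominates it on the whole interval.\<close>
  have mono: "1 / sqrt y - 1 / sqrt (y + 3) \<le> D" if y: "A \<le> y" for y
  proof -
    have "\<exists>y'. ((\<lambda>y. 1 / sqrt y - 1 / sqrt (y + 3)) has_real_derivative y') (at x) \<and> y' \<le> 0"
      if "A \<le> x" "x \<le> y" for x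
    proof (intro exI conjI)
      have x: "x > 0" using that assms by simp
      show "((\<lambda>y. 1 / sqrt y - 1 / sqrt (y + 3)) has_real_derivative
        (- (1 / 2 / (x * sqrt x)) + 1 / 2 / ((x + 3) * sqrt (x + 3)))) (at x)"
        using x by (auto intro!: derivative_eq_intros simp: field_simps)
      have "1 / 2 / ((x + 3) * sqrt (x + 3)) \<le> 1 / 2 / (x * sqrt x)"
        using x by (intro divide_left_mono mult_mono mult_pos_pos) auto
      then show "- (1 / 2 / (x * sqrt x)) + 1 / 2 / ((x + 3) * sqrt (x + 3)) \<le> 0" by simp
    qed
    then show ?thesis unfolding D_def by (rule DERIV_nonpos_imp_nonincreasing[OF y])
  qed
  have "\<phi> A \<le> \<phi> B"
  proof (rule DERIV_nonneg_imp_nondecreasing[OF assms(2)])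
    fix x assume x: "A \<le> x" "x \<le> B"
    then have x0: "x > 0" using assms by simp
    have "(\<phi> has_real_derivative (D * (1 / 3 + 3 / 4 / x) - 1 / 2 / (x * sqrt x))) (at x)"
      unfolding \<phi>_def using x0 by (auto intro!: derivative_eq_intros simp: field_simps)
    moreover have "1 / 2 / (x * sqrt x) \<le> D * (1 / 3 + 3 / 4 / x)"
      by (rule order.trans[OF key[OF x0]]) (intro mult_right_mono mono x, use x0 in auto)
    ultimately show "\<exists>y. (\<phi> has_real_derivative y) (at x) \<and> 0 \<le> y" by (auto intro: exI)
  qed
  then show ?thesis unfolding \<phi>_def D_def[symmetric] by (simp add: algebra_simps diff_divide_distrib)
qed

section \<open>Adding the summands one at a time\<close>

text \<open>The slope in the overlap bound is the drop from \<open>A\<close> to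
  \<open>A + 3\<close>, since two coins shift the parameter by 3. \<open>inverse_sqrt_step\<close>
  then tells how far \<open>B\<close> may exceed \<open>A\<close> for a given overlap.\<close>

lemma smoothing_one_summand:
  fixes F V :: "real fps" and A :: real
  assumes A: "A \<ge> 1" and V: "l1 V"
    and s: "\<And>j. norm1 (fair ^ j * V) \<le> 2 / sqrt (A + 3/2 * real j)"
    and F: "\<And>k. 0 \<le> fps_nth F k" "fps_nth F sums 1"
    and o: "(\<lambda>k. min (fps_nth F k) (fps_nth F (Suc k))) sums \<theta>"
    and B: "A \<le> B" "(B - A) / 3 + 3/4 * (ln B - ln A) \<le> \<theta>"
  shows "norm1 (F * V) \<le> 2 / sqrt B"
proof -
  let ?D = "1 / sqrt A - 1 / sqrt (A + 3)"
  have D: "?D \<ge> 0" using A by (auto intro!: divide_left_mono)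
  have "norm1 (F * V) \<le> 2 / sqrt A * 1 - (2 / sqrt A - 2 / sqrt (A + 3)) * \<theta>"
  proof (rule norm1_mult_le_overlap[OF V _ F o])
    fix m :: nat assume m: "m > 0"
    show "norm1 (interval_fps m * V) \<le> 2 / sqrt A + (real m - 1) * (2 / sqrt (A + 3))"
    proof (rule norm1_interval_mult_le[OF V _ _ _ _ _ _ _ m, where ?s1.0 = "2 / sqrt (A + 3/2)"
          and ?s3.0 = "2 / sqrt (A + 9/2)"])
      show "2 * (2 / sqrt (A + 3 / 2)) \<le> 2 / sqrt A + 2 / sqrt (A + 3)"
        using inverse_sqrt_interpolation(1)[OF A] by simp
      show "2 / sqrt (A + 3 / 2) + 2 * (2 / sqrt (A + 9 / 2)) \<le> 3 * (2 / sqrt (A + 3))"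
        using inverse_sqrt_interpolation(2)[OF A] by simp
      show "2 / sqrt (A + 9 / 2) \<le> 2 / sqrt (A + 3)"
        using A by (intro divide_left_mono) auto
    qed (use s[of 0] s[of 1] s[of 2] s[of 3] in auto)
  qed
  also have "\<dots> = 2 * (1 / sqrt A - ?D * \<theta>)" by (simp add: algebra_simps)
  also have "\<dots> \<le> 2 * (1 / sqrt B)"
    using inverse_sqrt_step[of A B] mult_left_mono[OF B(2) D] A B(1) by simp
  finally show ?thesis by simp
qed

text \<open>\<open>k\<close> has to be arbitrary because one more summand tests the partial product
  against up to three further coins; \<open>g\<close> because the induction hypothesis is applied to
  a smaller parameter.\<close>

lemma smoothing_prod_aux:
  fixes F :: "'i \<Rightarrow> real fps" and \<theta> :: "'i \<Rightarrow> real"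
  assumes "finite I"
    and "\<And>i k. i \<in> I \<Longrightarrow> 0 \<le> fps_nth (F i) k" "\<And>i. i \<in> I \<Longrightarrow> fps_nth (F i) sums 1"
    and "\<And>i. i \<in> I \<Longrightarrow> (\<lambda>k. min (fps_nth (F i) k) (fps_nth (F i) (Suc k))) sums \<theta> i"
    and "g \<ge> 1" "(g - 1) / 3 + 3/4 * ln g \<le> (\<Sum>i\<in>I. \<theta> i)"
  shows "norm1 (fair ^ k * ((\<Prod>i\<in>I. F i) * (1 - fps_X))) \<le> 2 / sqrt (g + 3/2 * real k)"
  using assms
proof (induction I arbitrary: g k rule: finite_induct)
  case empty
  then have "(g - 1) / 3 + 3/4 * ln g \<le> 0" by simp
  then have "g \<le> 1" using ln_ge_zero[OF empty.prems(4)] by (simp add: field_simps)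
  then have "g = 1" using empty by simp
  then show ?case using norm1_fair_power_diff_le[of k] by (simp add: add.commute)
next
  case (insert i I)
  define \<Lambda> where "\<Lambda> x = (x - 1) / 3 + 3/4 * ln x" for x :: real
  have mono: "\<Lambda> x \<le> \<Lambda> y" if "1 \<le> x" "x \<le> y" for x y
    unfolding \<Lambda>_def using that by (intro add_mono divide_right_mono) auto
  have \<theta>0: "\<theta> j \<ge> 0" if "j \<in> insert i I" for j
    by (rule sums_le[OF _ sums_zero insert.prems(3)[OF that]]) (use insert.prems(1)[OF that] in auto)
  have g: "1 \<le> g" "\<Lambda> g \<le> \<theta> i + (\<Sum>i\<in>I. \<theta> i)"
    using insert by (auto simp: \<Lambda>_def)
  \<comment> \<open>Up to \<open>h\<close> the growth is paid for by \<open>I\<close>, from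
    \<open>h\<close> to \<open>g\<close> by the new summand. If that summand can pay for all of it,
    \<open>h = 1\<close>; otherwise \<open>h\<close> is placed so that its overlap is spent
    completely.\<close>
  have "\<exists>h\<ge>1. h \<le> g \<and> \<Lambda> h \<le> (\<Sum>i\<in>I. \<theta> i) \<and> \<Lambda> g - \<Lambda> h \<le> \<theta> i"
  proof (cases "\<Lambda> g \<le> \<theta> i")
    case True
    have "(\<Sum>i\<in>I. \<theta> i) \<ge> 0" using \<theta>0 by (intro sum_nonneg) auto
    then show ?thesis using True g by (intro exI[of _ 1]) (auto simp: \<Lambda>_def)
  next
    case False
    have "\<exists>h\<ge>1. h \<le> g \<and> \<Lambda> h = \<Lambda> g - \<theta> i"
    proof (rule IVT')
      show "continuous_on {1..g} \<Lambda>" unfolding \<Lambda>_def by (intro continuous_intros) auto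
    qed (use False g \<theta>0[of i] in \<open>auto simp: \<Lambda>_def\<close>)
    then show ?thesis using g by auto
  qed
  then obtain h where h: "1 \<le> h" "h \<le> g" "\<Lambda> h \<le> (\<Sum>i\<in>I. \<theta> i)" "\<Lambda> g - \<Lambda> h \<le> \<theta> i" by blast
  have l1F: "l1 (F j)" if "j \<in> insert i I" for j
    using insert.prems(1,2)[OF that] by (simp add: l1_def sums_iff)
  define V where "V = fair ^ k * ((\<Prod>i\<in>I. F i) * (1 - fps_X))"
  have V: "l1 V" unfolding V_def
    by (intro l1_mult l1_power l1_fair l1_prod l1_diff l1_1 l1_X l1F) auto
  have "norm1 (F i * V) \<le> 2 / sqrt (g + 3/2 * real k)"
  proof (rule smoothing_one_summand[where A = "h + 3/2 * real k" and F = "F i", OF _ V])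
    fix j
    have "fair ^ j * V = fair ^ (j + k) * ((\<Prod>i\<in>I. F i) * (1 - fps_X))"
      by (simp add: V_def power_add mult.assoc)
    also have "norm1 \<dots> \<le> 2 / sqrt (h + 3/2 * real (j + k))"
      using h unfolding \<Lambda>_def by (intro insert.IH insert.prems) auto
    also have "h + 3/2 * real (j + k) = h + 3/2 * real k + 3/2 * real j" by simp
    finally show "norm1 (fair ^ j * V) \<le> 2 / sqrt (h + 3/2 * real k + 3/2 * real j)" .
  next
    \<comment> \<open>The coins shift both parameters by \<open>c\<close>. A common shift shrinks
      the increment of the logarithm, so the budget computed without coins suffices.\<close>
    define c where "c = 3/2 * real k"
    have c: "c \<ge> 0" "h + c > 0" "g + c > 0" using h by (auto simp: c_def)
    have "(g + c) * h \<le> g * (h + c)"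
      using mult_left_mono[OF h(2) c(1)] by (simp add: algebra_simps)
    then have "ln ((g + c) * h) \<le> ln (g * (h + c))"
      using h c by (intro ln_mono mult_pos_pos) auto
    moreover have "ln ((g + c) * h) = ln (g + c) + ln h" "ln (g * (h + c)) = ln g + ln (h + c)"
      using h c by (auto simp: ln_mult)
    ultimately have "ln (g + c) - ln (h + c) \<le> ln g - ln h" by simp
    then have "(g + c - (h + c)) / 3 + 3/4 * (ln (g + c) - ln (h + c)) \<le> \<Lambda> g - \<Lambda> h"
      unfolding \<Lambda>_def by (simp add: field_simps)
    also note h(4)
    finally show "(g + 3/2 * real k - (h + 3/2 * real k)) / 3
        + 3/4 * (ln (g + 3/2 * real k) - ln (h + 3/2 * real k)) \<le> \<theta> i"
      by (simp add: c_def)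
  qed (use h insert.prems in auto)
  then show ?case using insert.hyps by (simp add: V_def mult_ac)
qed

lemma smoothing_prod:
  fixes F :: "'i \<Rightarrow> real fps" and \<theta> :: "'i \<Rightarrow> real"
  assumes I: "finite I"
    and F: "\<And>i k. i \<in> I \<Longrightarrow> 0 \<le> fps_nth (F i) k" "\<And>i. i \<in> I \<Longrightarrow> fps_nth (F i) sums 1"
    and o: "\<And>i. i \<in> I \<Longrightarrow> (\<lambda>k. min (fps_nth (F i) k) (fps_nth (F i) (Suc k))) sums \<theta> i"
  shows "norm1 ((\<Prod>i\<in>I. F i) * (1 - fps_X)) \<le> 2 * sqrt (2 / pi) * (1/4 + (\<Sum>i\<in>I. \<theta> i)) powr (-1/2)"
proof -
  define \<Lambda> where "\<Lambda> x = (x - 1) / 3 + 3/4 * ln x" for x :: real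
  define l where "l = (\<Sum>i\<in>I. \<theta> i)"
  have "\<theta> j \<ge> 0" if "j \<in> I" for j
    by (rule sums_le[OF _ sums_zero o[OF that]]) (use F(1)[OF that] in auto)
  then have l0: "l \<ge> 0" unfolding l_def by (intro sum_nonneg)
  \<comment> \<open>At \<open>3 * l + 1\<close> the linear part of \<Lambda> alone already reaches
    \<open>l\<close>.\<close>
  have "\<exists>g\<ge>1. g \<le> 3 * l + 1 \<and> \<Lambda> g = l"
  proof (rule IVT')
    show "continuous_on {1..3 * l + 1} \<Lambda>" unfolding \<Lambda>_def by (intro continuous_intros) auto
  qed (use l0 in \<open>auto simp: \<Lambda>_def\<close>)
  then obtain g where g: "g \<ge> 1" "\<Lambda> g = l" by blast
  \<comment> \<open>5/2 is a rational stand-in for Euler's number: the tangent of \<open>ln\<close>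
    at this point, together with \<open>ln (5/2) \<le> 1\<close>, gives
    \<open>ln g \<le> 2/5 * g\<close>.\<close>
  have "exp (1::real) \<ge> 5/2" using exp_lower_Taylor_quadratic[of 1] by simp
  then have "ln (5/2 :: real) \<le> 1" using ln_mono[of "5/2" "exp 1 :: real"] by simp
  moreover have "ln g = ln (g / (5/2)) + ln (5/2)"
    using g by (subst ln_div) auto
  moreover have "ln (g / (5/2)) \<le> g / (5/2) - 1" using g by (intro ln_le_minus_one) auto
  ultimately have lng: "ln g \<le> 2/5 * g" by simp
  \<comment> \<open>The coefficient obtained is \<open>1/3 + 3/4 * 2/5 = 19/30\<close>, and the
    constants \<open>1/4 - 1/3\<close> add up to something negative. The intermediate 7/11 is 2
    divided by 22/7, hence below \<open>2 / pi\<close>.\<close>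
  have "1/4 + l \<le> 7/11 * g" using lng g unfolding \<Lambda>_def by (simp add: field_simps)
  also have "\<dots> \<le> 2 / pi * g"
    using g pi_less_4 pi_approx by (intro mult_right_mono) (auto simp: field_simps)
  finally have "sqrt (1/4 + l) \<le> sqrt (2 / pi) * sqrt g"
    by (metis real_sqrt_le_mono real_sqrt_mult)
  moreover have "sqrt g > 0" "sqrt (1/4 + l) > 0" using g l0 by auto
  ultimately have "1 / sqrt g \<le> sqrt (2 / pi) * (1 / sqrt (1/4 + l))"
    by (simp add: field_simps)
  also have "1 / sqrt (1/4 + l) = (1/4 + l) powr (-1/2)"
    using l0 powr_half_sqrt[of "1/4 + l"] powr_minus_divide[of "1/4 + l" "1/2"]
    by (simp only: minus_divide_left)
  finally have *: "1 / sqrt g \<le> sqrt (2 / pi) * (1/4 + l) powr (-1/2)" .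
  have "norm1 ((\<Prod>i\<in>I. F i) * (1 - fps_X)) \<le> 2 / sqrt g"
    using smoothing_prod_aux[OF I F o g(1), where k = 0] g(2) unfolding \<Lambda>_def l_def by simp
  also have "\<dots> \<le> 2 * sqrt (2 / pi) * (1/4 + l) powr (-1/2)"
    using mult_left_mono[OF *, of 2] by (simp only: mult.assoc times_divide_eq_right mult_1_right)
  finally show ?thesis unfolding l_def .
qed


subsection \<open>Stein's method for the negative binomial distribution\<close>

text \<open>Stein's method sees the weights only through this ratio recursion, the detailed balance
  behind the Stein operator. The explicit binomial form enters only in
  \<open>neg_binomial_nb_pmf\<close>.\<close>

locale neg_binomial =
  fixes \<alpha> q :: real and w :: "nat \<Rightarrow> real"
  assumes \<alpha>_pos: "\<alpha> > 0" and q_pos: "0 < q" and q_le: "q \<le> 1"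
    and w_pos: "w k > 0"
    and w_Suc: "real (Suc k) * w (Suc k) = q * (\<alpha> + real k) * w k"
    and w_sums: "w sums 1"
begin

definition nb_cdf :: "nat \<Rightarrow> real" where
  "nb_cdf k = (\<Sum>i<k. w i)"

lemma nb_cdf_nonneg: "0 \<le> nb_cdf k"
  unfolding nb_cdf_def using w_pos by (intro sum_nonneg) (auto intro: less_imp_le)

lemma tail_sums: "(\<lambda>i. w (i + k)) sums (1 - nb_cdf k)"
  unfolding nb_cdf_def by (rule sums_split_initial_segment[OF w_sums])

lemma nb_cdf_le_1: "nb_cdf k \<le> 1"
  using sums_le[OF _ sums_zero tail_sums[of k]] w_pos by (simp add: less_imp_le)

text \<open>Split \<open>\<alpha> + k\<close> into \<open>\<alpha> + i\<close> and
  \<open>k - i\<close>. The recursion turns the first part into \<open>(i + 1) * w (i + 1)\<close>,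
  \<open>q \<le> 1\<close> frees the second from its factor, and together they give
  \<open>k * w i\<close> for all \<open>i \<le> k\<close>.\<close>

lemma nb_cdf_growth: "q * (\<alpha> + real k) * nb_cdf k \<le> real k * nb_cdf (Suc k)"
proof -
  have "q * (\<alpha> + real k) * nb_cdf k = (\<Sum>i<k. real (Suc i) * w (Suc i) + q * (real k - real i) * w i)"
    unfolding w_Suc nb_cdf_def sum_distrib_left by (intro sum.cong) (auto simp: algebra_simps)
  also have "\<dots> \<le> (\<Sum>i<k. real (Suc i) * w (Suc i) + (real k - real i) * w i)"
    using q_le w_pos by (intro sum_mono add_left_mono mult_right_mono mult_left_le_one_le)
      (use q_pos in \<open>auto intro: less_imp_le\<close>)
  also have "\<dots> = (\<Sum>i<k. real (Suc i) * w (Suc i)) + (\<Sum>i<k. (real k - real i) * w i)"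
    by (rule sum.distrib)
  also have "(\<Sum>i<k. real (Suc i) * w (Suc i)) = (\<Sum>i<Suc k. real i * w i)"
    by (subst sum.lessThan_Suc_shift) simp
  also have "(\<Sum>i<k. (real k - real i) * w i) = (\<Sum>i<Suc k. (real k - real i) * w i)"
    by simp
  also have "(\<Sum>i<Suc k. real i * w i) + (\<Sum>i<Suc k. (real k - real i) * w i) = real k * nb_cdf (Suc k)"
    unfolding nb_cdf_def sum_distrib_left sum.distrib[symmetric]
    by (intro sum.cong) (auto simp: algebra_simps)
  finally show ?thesis .
qed

text \<open>Termwise: beyond \<open>k\<close> the ratio of consecutive weights,
  \<open>q * (\<alpha> + i) / (i + 1)\<close>, is at most
  \<open>q * (\<alpha> + k) / k\<close>.\<close>

lemma tail_decay: "real k * (1 - nb_cdf (Suc k)) \<le> q * (\<alpha> + real k) * (1 - nb_cdf k)"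
proof (rule sums_le[OF _ sums_mult[OF tail_sums] sums_mult[OF tail_sums]])
  fix i
  have "real k * (\<alpha> + real (i + k)) \<le> (\<alpha> + real k) * real (Suc (i + k))"
    using \<alpha>_pos by (simp add: algebra_simps)
  then have "q * w (i + k) * (real k * (\<alpha> + real (i + k))) \<le> q * w (i + k) * ((\<alpha> + real k) * real (Suc (i + k)))"
    using q_pos w_pos[of "i + k"] by (intro mult_left_mono) auto
  moreover have "real (Suc (i + k)) * (real k * w (Suc (i + k))) = real k * (real (Suc (i + k)) * w (Suc (i + k)))"
    by (rule mult.left_commute)
  then have "real (Suc (i + k)) * (real k * w (Suc (i + k))) = q * w (i + k) * (real k * (\<alpha> + real (i + k)))"
    unfolding w_Suc by (simp only: mult_ac)
  ultimately have "real (Suc (i + k)) * (real k * w (Suc (i + k))) \<le>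
      q * w (i + k) * ((\<alpha> + real k) * real (Suc (i + k)))"
    by (simp only:)
  also have "\<dots> = real (Suc (i + k)) * (q * (\<alpha> + real k) * w (i + k))"
    by (simp only: mult_ac)
  finally show "real k * w (i + Suc k) \<le> q * (\<alpha> + real k) * w (i + k)"
    by (simp del: of_nat_Suc)
qed

text \<open>The value of the Stein solution at \<open>0\<close> is irrelevant (it is \<open>0 / 0 = 0\<close> here).\<close>

definition stein_sol :: "(nat \<Rightarrow> real) \<Rightarrow> nat \<Rightarrow> real" where
  "stein_sol h k = (\<Sum>i<k. w i * (h i - (\<Sum>j. w j * h j))) / (real k * w k)"

lemma stein_sol_mult:
  "real k * w k * stein_sol h k = (\<Sum>i<k. w i * (h i - (\<Sum>j. w j * h j)))"
  using w_pos[of k] by (cases k) (auto simp: stein_sol_def)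

lemma stein_equation:
  "q * (\<alpha> + real k) * stein_sol h (Suc k) - real k * stein_sol h k = h k - (\<Sum>j. w j * h j)"
proof -
  have "w k * (q * (\<alpha> + real k) * stein_sol h (Suc k) - real k * stein_sol h k)
      = real (Suc k) * w (Suc k) * stein_sol h (Suc k) - real k * w k * stein_sol h k"
    unfolding w_Suc by (simp add: algebra_simps)
  also have "\<dots> = w k * (h k - (\<Sum>j. w j * h j))"
    unfolding stein_sol_mult by simp
  finally show ?thesis using w_pos[of k] by simp
qed

context
  fixes h :: "nat \<Rightarrow> real"
  assumes h: "\<And>k. 0 \<le> h k" "\<And>k. h k \<le> 1"
begin

lemma summable_w_mult: "summable (\<lambda>i. w i * h i)"
  by (rule summable_comparison_test'[OF sums_summable[OF w_sums], of 0])
     (use h w_pos in \<open>auto simp: abs_mult less_imp_le intro: mult_left_le\<close>)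

lemma partial_expectation:
  shows "0 \<le> (\<Sum>i<k. w i * h i)" "(\<Sum>i<k. w i * h i) \<le> nb_cdf k"
    and "(\<Sum>i<k. w i * h i) \<le> (\<Sum>i. w i * h i)"
    and "(\<Sum>i. w i * h i) - (\<Sum>i<k. w i * h i) \<le> 1 - nb_cdf k"
proof -
  have pos: "0 \<le> w i * h i" "w i * h i \<le> w i" for i
    using h[of i] w_pos[of i] by (auto intro: mult_left_le)
  show "0 \<le> (\<Sum>i<k. w i * h i)" by (intro sum_nonneg pos)
  show "(\<Sum>i<k. w i * h i) \<le> nb_cdf k" unfolding nb_cdf_def by (intro sum_mono pos)
  have s: "(\<lambda>i. w (i + k) * h (i + k)) sums ((\<Sum>i. w i * h i) - (\<Sum>i<k. w i * h i))"
    by (rule sums_split_initial_segment[OF summable_sums[OF summable_w_mult]])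
  show "(\<Sum>i<k. w i * h i) \<le> (\<Sum>i. w i * h i)"
    using sums_le[OF _ sums_zero s] pos by simp
  show "(\<Sum>i. w i * h i) - (\<Sum>i<k. w i * h i) \<le> 1 - nb_cdf k"
    by (rule sums_le[OF _ s tail_sums]) (rule pos)
qed

lemma centered_sum:
  "(\<Sum>i<k. w i * (h i - (\<Sum>j. w j * h j))) = (\<Sum>i<k. w i * h i) - nb_cdf k * (\<Sum>j. w j * h j)"
  by (simp add: right_diff_distrib sum_subtractf nb_cdf_def sum_distrib_right)

text \<open>A crude bound that only serves to make series converge. \<open>tail_decay\<close>
  propagates the estimate of the tail by a multiple of \<open>k * w k\<close> upwards from
  \<open>k = 1\<close>; the centered sum is a difference of two nonnegative terms, each at most the
  tail.\<close>

lemma stein_sol_bounded: "\<bar>stein_sol h (Suc k)\<bar> \<le> 1 / w 1"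
proof -
  have tail: "1 - nb_cdf (Suc k) \<le> 1 / w 1 * (real (Suc k) * w (Suc k))" for k
  proof (induction k)
    case 0
    then show ?case using w_pos[of 1] w_pos[of 0] by (simp add: nb_cdf_def less_imp_le)
  next
    case (Suc k)
    have "real (Suc k) * (1 - nb_cdf (Suc (Suc k))) \<le> q * (\<alpha> + real (Suc k)) * (1 - nb_cdf (Suc k))"
      by (rule tail_decay)
    also have "\<dots> \<le> q * (\<alpha> + real (Suc k)) * (1 / w 1 * (real (Suc k) * w (Suc k)))"
      using q_pos \<alpha>_pos by (intro mult_left_mono Suc) auto
    also have "\<dots> = real (Suc k) * (1 / w 1 * (q * (\<alpha> + real (Suc k)) * w (Suc k)))"
      by (simp only: mult_ac)
    finally show ?case unfolding w_Suc[of "Suc k", symmetric] by (rule mult_left_le_imp_le) simp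
  qed
  let ?a = "\<Sum>i<Suc k. w i * h i" and ?m = "\<Sum>i. w i * h i" and ?c = "nb_cdf (Suc k)"
  have "\<bar>?a - ?c * ?m\<bar> = \<bar>?a * (1 - ?c) - ?c * (?m - ?a)\<bar>"
    by (simp add: algebra_simps)
  also have "\<dots> \<le> max (?a * (1 - ?c)) (?c * (?m - ?a))"
  proof -
    have "0 \<le> ?a * (1 - ?c)" "0 \<le> ?c * (?m - ?a)"
      using partial_expectation[of "Suc k"] nb_cdf_le_1[of "Suc k"] nb_cdf_nonneg[of "Suc k"]
      by (intro mult_nonneg_nonneg; linarith)+
    then show ?thesis by (simp only: max_def abs_if) (simp split: if_splits)
  qed
  also have "\<dots> \<le> 1 - ?c"
  proof (rule max.boundedI)
    have "?a * (1 - ?c) \<le> 1 * (1 - ?c)" "?c * (?m - ?a) \<le> 1 * (?m - ?a)"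
      using partial_expectation[of "Suc k"] nb_cdf_le_1[of "Suc k"]
      by (intro mult_right_mono; linarith)+
    then show "?a * (1 - ?c) \<le> 1 - ?c" "?c * (?m - ?a) \<le> 1 - ?c"
      using partial_expectation(4)[of "Suc k"] by (simp_all only: mult_1)
  qed
  also note tail[of k]
  finally have "\<bar>real (Suc k) * w (Suc k) * stein_sol h (Suc k)\<bar> \<le> 1 / w 1 * (real (Suc k) * w (Suc k))"
    unfolding stein_sol_mult centered_sum .
  then have "(real (Suc k) * w (Suc k)) * \<bar>stein_sol h (Suc k)\<bar> \<le> (real (Suc k) * w (Suc k)) * (1 / w 1)"
    using w_pos[of "Suc k"] by (simp add: abs_mult mult_ac)
  then show ?thesis using w_pos[of "Suc k"] by (subst (asm) mult_le_cancel_left_pos) auto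
qed

text \<open>The expectation of \<open>h\<close> is split into the parts below, at and above
  \<open>k\<close>. Growth of the distribution function and decay of the tail give the outer parts
  nonpositive coefficients, so only the atom at \<open>k\<close> can raise the solution, with
  coefficient at most \<open>1 / u\<close>.\<close>

lemma stein_sol_diff_upper:
  assumes k: "k > 0"
  shows "stein_sol h (Suc k) - stein_sol h k \<le> 1 / (\<alpha> * q)"
proof -
  define a where "a = (\<Sum>i<k. w i * h i)"
  define c where "c = w k * h k"
  define e where "e = (\<Sum>i. w i * h i) - a - c"
  define u where "u = q * (\<alpha> + real k)"
  define C where "C = nb_cdf k"
  define D where "D = nb_cdf (Suc k)"
  have u: "u > 0" "q * \<alpha> \<le> u" using q_pos \<alpha>_pos by (auto simp: u_def)
  have a0: "a \<ge> 0" and e0: "e \<ge> 0"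
    using partial_expectation(1)[of k] partial_expectation(3)[of "Suc k"] by (auto simp: a_def e_def c_def)
  have c0: "c \<ge> 0" "c \<le> w k" using h[of k] w_pos[of k] by (auto simp: c_def intro: mult_left_le)
  have D: "0 \<le> D" "D \<le> 1" "0 \<le> C" using nb_cdf_nonneg nb_cdf_le_1 by (auto simp: D_def C_def)
  have 1: "(1 - D) / u \<le> (1 - C) / real k"
    using tail_decay[of k] u k by (simp add: D_def C_def u_def[symmetric] field_simps)
  have 2: "C / real k \<le> D / u"
    using nb_cdf_growth[of k] u k by (simp add: D_def C_def u_def[symmetric] field_simps)
  have "w k * stein_sol h (Suc k) = ((a + c) * (1 - D) - D * e) / u"
  proof -
    have "u * (w k * stein_sol h (Suc k)) = real (Suc k) * w (Suc k) * stein_sol h (Suc k)"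
      unfolding w_Suc u_def by (simp add: mult_ac)
    also have "\<dots> = (a + c) * (1 - D) - D * e"
      unfolding stein_sol_mult centered_sum a_def c_def e_def D_def by (simp add: algebra_simps)
    finally show ?thesis using u by (simp add: field_simps)
  qed
  moreover have "w k * stein_sol h k = (a * (1 - C) - C * (c + e)) / real k"
  proof -
    have "real k * (w k * stein_sol h k) = a * (1 - C) - C * (c + e)"
      unfolding mult.assoc[symmetric] stein_sol_mult centered_sum a_def c_def e_def C_def
      by (simp add: algebra_simps)
    then show ?thesis using k by (simp add: field_simps)
  qed
  ultimately have "w k * (stein_sol h (Suc k) - stein_sol h k) =
     a * ((1 - D) / u - (1 - C) / real k) + e * (C / real k - D / u) + c * ((1 - D) / u + C / real k)"
    by (simp add: algebra_simps add_divide_distrib diff_divide_distrib)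
  also have "\<dots> \<le> 0 + 0 + c * ((1 - D) / u + C / real k)"
    using 1 2 a0 e0 by (intro add_mono mult_nonneg_nonpos order.refl) auto
  also have "\<dots> \<le> c * ((1 - D) / u + D / u)"
    using 2 c0 by (simp add: mult_left_mono)
  also have "\<dots> = c * (1 / u)" by (simp add: add_divide_distrib[symmetric])
  also have "\<dots> \<le> w k * (1 / (\<alpha> * q))"
    using c0 u q_pos \<alpha>_pos w_pos[of k]
    by (intro mult_mono divide_left_mono) (auto simp: mult.commute)
  finally show ?thesis by (rule mult_left_le_imp_le) (rule w_pos)
qed

end

lemma stein_sol_diff:
  assumes h: "\<And>k. 0 \<le> h k" "\<And>k. h k \<le> 1" and k: "k > 0"
  shows "\<bar>stein_sol h (Suc k) - stein_sol h k\<bar> \<le> 1 / (\<alpha> * q)"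
proof -
  \<comment> \<open>Complementing the test function negates the solution, so the upper bound also
    yields the lower one.\<close>
  have "(\<lambda>j. w j * (1 - h j)) sums (1 - (\<Sum>j. w j * h j))"
    using sums_diff[OF w_sums summable_sums[OF summable_w_mult[of h, OF h]]] by (simp add: algebra_simps)
  then have "(\<Sum>j. w j * (1 - h j)) = 1 - (\<Sum>j. w j * h j)" by (rule sums_unique[symmetric])
  then have "w i * ((1 - h i) - (\<Sum>j. w j * (1 - h j))) = - (w i * (h i - (\<Sum>j. w j * h j)))" for i
    by (simp add: right_diff_distrib)
  then have "stein_sol (\<lambda>j. 1 - h j) j = - stein_sol h j" for j
    unfolding stein_sol_def by (simp only: sum_negf minus_divide_left)
  then show ?thesis
    using stein_sol_diff_upper[of h, OF h k] stein_sol_diff_upper[of "\<lambda>j. 1 - h j", OF _ _ k] h by simp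
qed

lemma stein_bound:
  fixes F R :: "real fps"
  assumes F: "\<And>k. 0 \<le> fps_nth F k" "fps_nth F sums 1"
    and mean: "summable (\<lambda>k. real k * fps_nth F k)"
    and R: "l1 R"
    and eq: "fps_const (q * \<alpha>) * F - (1 - fps_const q * fps_X) * fps_deriv F = (1 - fps_X) * R"
  shows "(\<Sum>k. \<bar>fps_nth F k - w k\<bar>) / 2 \<le> 1 / (\<alpha> * q) * norm1 R"
proof -
  let ?f = "fps_nth F"
  \<comment> \<open>The indicator of the set where \<open>F\<close> exceeds \<open>w\<close> attains
    the total variation distance as a difference of expectations.\<close>
  define h :: "nat \<Rightarrow> real" where "h k = (if ?f k > w k then 1 else 0)" for k
  define g where "g = stein_sol h"
  define m where "m = (\<Sum>j. w j * h j)"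
  have h: "\<And>k. 0 \<le> h k" "\<And>k. h k \<le> 1" by (auto simp: h_def)
  have sumf: "summable ?f" using F(2) by (simp add: sums_iff)
  have sfh: "summable (\<lambda>k. ?f k * h k)"
    by (rule summable_comparison_test'[OF sumf, of 0])
       (use h F(1) in \<open>auto simp: abs_mult intro: mult_left_le\<close>)
  have swh: "(\<lambda>k. w k * h k) sums m"
    unfolding m_def by (rule summable_sums[OF summable_w_mult[of h, OF h]])
  define d where "d = (\<Sum>k. ?f k * h k) - m"
  have d: "(\<lambda>k. ?f k * (h k - m)) sums d"
    using sums_diff[OF summable_sums[OF sfh] sums_mult[OF F(2), of m]]
    by (simp add: d_def algebra_simps)
  have "(\<lambda>k. 2 * (?f k * h k - w k * h k) - (?f k - w k)) sums (2 * d - (1 - 1))"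
    unfolding d_def by (intro sums_diff sums_mult F(2) w_sums summable_sums[OF sfh] swh)
  moreover have "(\<lambda>k. 2 * (?f k * h k - w k * h k) - (?f k - w k)) = (\<lambda>k. \<bar>?f k - w k\<bar>)"
    by (auto simp: h_def)
  ultimately have tv: "(\<Sum>k. \<bar>?f k - w k\<bar>) / 2 = d" by (simp add: sums_iff)
  have gb: "\<bar>g (Suc k)\<bar> \<le> 1 / w 1" for k
    unfolding g_def by (rule stein_sol_bounded[of h, OF h])
  have s1: "summable (\<lambda>k. q * (\<alpha> + real k) * ?f k * g (Suc k))"
  proof (rule summable_comparison_test')
    have "summable (\<lambda>k. \<alpha> * ?f k + real k * ?f k)"
      by (intro summable_add summable_mult sumf mean)
    then show "summable (\<lambda>k. q * (\<alpha> * ?f k + real k * ?f k) * (1 / w 1))"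
      by (intro summable_mult2 summable_mult)
    fix k :: nat
    have "norm (q * (\<alpha> + real k) * ?f k * g (Suc k)) = q * (\<alpha> + real k) * ?f k * \<bar>g (Suc k)\<bar>"
      using q_pos \<alpha>_pos F(1)[of k] by (simp add: abs_mult)
    also have "\<dots> \<le> q * (\<alpha> + real k) * ?f k * (1 / w 1)"
      using q_pos \<alpha>_pos F(1)[of k] by (intro mult_left_mono gb) auto
    finally show "norm (q * (\<alpha> + real k) * ?f k * g (Suc k)) \<le> q * (\<alpha> * ?f k + real k * ?f k) * (1 / w 1)"
      by (simp add: algebra_simps)
  qed
  have eqn: "?f k * (h k - m) = q * (\<alpha> + real k) * ?f k * g (Suc k) - real k * ?f k * g k" for k
    unfolding g_def m_def stein_equation[of k h, symmetric] by (simp add: algebra_simps)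
  have "(\<lambda>k. q * (\<alpha> + real k) * ?f k * g (Suc k) - ?f k * (h k - m)) sums
      ((\<Sum>k. q * (\<alpha> + real k) * ?f k * g (Suc k)) - d)"
    by (intro sums_diff summable_sums[OF s1] d)
  then have "(\<lambda>k. real k * ?f k * g k) sums ((\<Sum>k. q * (\<alpha> + real k) * ?f k * g (Suc k)) - d)"
    unfolding eqn by simp
  \<comment> \<open>The term at 0 carries the factor \<open>real 0\<close>, so the index shift costs
    nothing and \<open>g 0\<close> drops out.\<close>
  then have "(\<lambda>k. real (Suc k) * ?f (Suc k) * g (Suc k)) sums ((\<Sum>k. q * (\<alpha> + real k) * ?f k * g (Suc k)) - d)"
    using sums_Suc_iff[of "\<lambda>k. real k * ?f k * g k"] by simp
  from sums_diff[OF summable_sums[OF s1] this]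
  have "(\<lambda>k. q * (\<alpha> + real k) * ?f k * g (Suc k) - real (Suc k) * ?f (Suc k) * g (Suc k)) sums d"
    by simp
  moreover have "q * (\<alpha> + real k) * ?f k - real (Suc k) * ?f (Suc k) = fps_nth ((1 - fps_X) * R) k" for k
    unfolding eq[symmetric] by (cases k) (auto simp: algebra_simps)
  then have "q * (\<alpha> + real k) * ?f k * g (Suc k) - real (Suc k) * ?f (Suc k) * g (Suc k)
      = g (Suc k) * fps_nth ((1 - fps_X) * R) k" for k
    by (metis left_diff_distrib mult.commute)
  ultimately have d2: "(\<lambda>k. g (Suc k) * fps_nth ((1 - fps_X) * R) k) sums d" by simp
  have sR: "summable (\<lambda>k. g (Suc (k + j)) * fps_nth R k)" for j
  proof (rule summable_comparison_test')
    show "summable (\<lambda>k. 1 / w 1 * \<bar>fps_nth R k\<bar>)" using R by (intro summable_mult) (simp add: l1_def)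
    show "norm (g (Suc (k + j)) * fps_nth R k) \<le> 1 / w 1 * \<bar>fps_nth R k\<bar>" for k
      using gb[of "k + j"] by (simp add: abs_mult mult_right_mono del: times_divide_eq_left)
  qed
  \<comment> \<open>Multiplication by \<open>fps_X\<close> is a shift of coefficients, so under the
    sum it becomes a shift in the argument of \<open>g\<close>; the factor \<open>1 - fps_X\<close>
    thus turns into an increment of \<open>g\<close>.\<close>
  have "(\<lambda>k. g (Suc k) * fps_nth (fps_X * R) k) sums (\<Sum>k. g (Suc (k + 1)) * fps_nth R k)"
    using summable_sums[OF sR[of 1]] sums_Suc_iff[of "\<lambda>k. g (Suc k) * fps_nth (fps_X * R) k"]
    by simp
  from sums_diff[OF summable_sums[OF sR[of 0]] this]
  have "(\<lambda>k. g (Suc k) * fps_nth ((1 - fps_X) * R) k) sums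
      ((\<Sum>k. g (Suc k) * fps_nth R k) - (\<Sum>k. g (Suc (Suc k)) * fps_nth R k))"
    by (simp add: algebra_simps)
  then have deq: "d = (\<Sum>k. g (Suc k) * fps_nth R k) - (\<Sum>k. g (Suc (Suc k)) * fps_nth R k)"
    using d2 sums_unique2 by blast
  have "(\<lambda>k. - (g (Suc (Suc k)) - g (Suc k)) * fps_nth R k) sums d"
    unfolding deq using sums_diff[OF summable_sums[OF sR[of 0]] summable_sums[OF sR[of 1]]] by (simp add: algebra_simps)
  moreover have "(\<lambda>k. 1 / (\<alpha> * q) * \<bar>fps_nth R k\<bar>) sums (1 / (\<alpha> * q) * norm1 R)"
    using R unfolding l1_def norm1_def by (intro sums_mult summable_sums)
  moreover have "- (g (Suc (Suc k)) - g (Suc k)) * fps_nth R k \<le> 1 / (\<alpha> * q) * \<bar>fps_nth R k\<bar>" for k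
  proof -
    have "- (g (Suc (Suc k)) - g (Suc k)) * fps_nth R k \<le> \<bar>g (Suc (Suc k)) - g (Suc k)\<bar> * \<bar>fps_nth R k\<bar>"
      by (metis abs_ge_self abs_minus_cancel abs_mult)
    also have "\<dots> \<le> 1 / (\<alpha> * q) * \<bar>fps_nth R k\<bar>"
      unfolding g_def by (intro mult_right_mono stein_sol_diff h) auto
    finally show ?thesis .
  qed
  ultimately show ?thesis unfolding tv by (rule sums_le[rotated 1])
qed

end

lemma neg_binomial_nb_pmf:
  assumes "\<alpha> > 0" "0 < p" "p < 1"
  shows "neg_binomial \<alpha> (1 - p) (nb_pmf \<alpha> p)"
proof
  show rec: "real (Suc k) * nb_pmf \<alpha> p (Suc k) = (1 - p) * (\<alpha> + real k) * nb_pmf \<alpha> p k" for k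
  proof -
    have "real (Suc k) * nb_pmf \<alpha> p (Suc k) =
        (real (Suc k) * ((\<alpha> + real k) gchoose Suc k)) * (p powr \<alpha> * (1 - p) ^ Suc k)"
      by (simp add: nb_pmf_def)
    also have "\<dots> = (1 - p) * (\<alpha> + real k) * nb_pmf \<alpha> p k"
      unfolding gbinomial_absorption by (simp add: nb_pmf_def)
    finally show ?thesis .
  qed
  show "nb_pmf \<alpha> p k > 0" for k
  proof (induction k)
    case 0
    then show ?case using assms by (simp add: nb_pmf_def)
  next
    case (Suc k)
    then have "0 < real (Suc k) * nb_pmf \<alpha> p (Suc k)"
      unfolding rec using assms by (intro mult_pos_pos) auto
    then show ?case by (simp add: zero_less_mult_iff)
  qed
  \<comment> \<open>The normalization is Newton's binomial series for
    \<open>p powr (- \<alpha>)\<close>, after negating the upper index of the coefficients.\<close>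
  have "(\<lambda>n. ((- \<alpha>) gchoose n) * (p - 1) ^ n) sums (1 + (p - 1)) powr (- \<alpha>)"
    using assms by (intro gen_binomial_real) auto
  then have "(\<lambda>n. ((- \<alpha>) gchoose n) * (p - 1) ^ n * p powr \<alpha>) sums (p powr (- \<alpha>) * p powr \<alpha>)"
    by (intro sums_mult2) simp
  moreover have "((- \<alpha>) gchoose n) * (p - 1) ^ n * p powr \<alpha> = nb_pmf \<alpha> p n" for n
  proof -
    have "((- \<alpha>) gchoose n) * (p - 1) ^ n = (\<alpha> + real n - 1 gchoose n) * ((-1) ^ n * (p - 1) ^ n)"
      by (simp add: gbinomial_minus)
    also have "(-1) ^ n * (p - 1) ^ n = (1 - p) ^ n" by (simp add: power_mult_distrib[symmetric])
    finally show ?thesis by (simp add: nb_pmf_def)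
  qed
  ultimately show "nb_pmf \<alpha> p sums 1" using assms by (simp add: powr_minus)
qed (use assms in auto)


subsection \<open>Division by powers of \<open>1 - X\<close>\<close>

lemma one_minus_X_mult_partial_sums: "(1 - fps_X) * Abs_fps (\<lambda>m. \<Sum>j\<le>m. fps_nth P j) = (P :: real fps)"
proof (rule fps_ext)
  fix n show "fps_nth ((1 - fps_X) * Abs_fps (\<lambda>m. \<Sum>j\<le>m. fps_nth P j)) n = fps_nth P n"
    by (cases n) (auto simp: algebra_simps)
qed

lemma abs_partial_sum_le_tail:
  fixes P :: "nat \<Rightarrow> real"
  assumes "summable (\<lambda>j. \<bar>P j\<bar>)" "P sums 0"
  shows "\<bar>\<Sum>j<m. P j\<bar> \<le> (\<Sum>j. \<bar>P (j + m)\<bar>)"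
proof -
  have "(\<lambda>j. P (j + m)) sums (0 - (\<Sum>j<m. P j))"
    by (rule sums_split_initial_segment[OF assms(2)])
  then have "\<bar>\<Sum>j<m. P j\<bar> = \<bar>\<Sum>j. P (j + m)\<bar>" by (simp add: sums_iff)
  also have "\<dots> \<le> (\<Sum>j. \<bar>P (j + m)\<bar>)"
    by (rule summable_rabs) (use assms(1) summable_iff_shift[of "\<lambda>j. \<bar>P j\<bar>" m] in simp)
  finally show ?thesis .
qed

lemma mult_tail_le:
  fixes P W :: "nat \<Rightarrow> real"
  assumes W: "mono W" "W 0 \<ge> 0" and s: "summable (\<lambda>j. \<bar>P j\<bar>)" "summable (\<lambda>j. W j * \<bar>P j\<bar>)"
  shows "W N * (\<Sum>j. \<bar>P (j + N)\<bar>) \<le> (\<Sum>j. W j * \<bar>P j\<bar>) - (\<Sum>j<N. W j * \<bar>P j\<bar>)"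
proof (rule sums_le)
  show "(\<lambda>j. W N * \<bar>P (j + N)\<bar>) sums (W N * (\<Sum>j. \<bar>P (j + N)\<bar>))"
    using s(1) summable_iff_shift[of "\<lambda>j. \<bar>P j\<bar>" N] by (intro sums_mult summable_sums) simp
  show "(\<lambda>j. W (j + N) * \<bar>P (j + N)\<bar>) sums ((\<Sum>j. W j * \<bar>P j\<bar>) - (\<Sum>j<N. W j * \<bar>P j\<bar>))"
    by (rule sums_split_initial_segment[OF summable_sums[OF s(2)]])
  show "W N * \<bar>P (j + N)\<bar> \<le> W (j + N) * \<bar>P (j + N)\<bar>" for j
    using W by (intro mult_right_mono monoD[OF W(1)]) auto
qed

text \<open>As \<open>P\<close> sums to 0, its partial sum through \<open>m\<close> is minus the
  tail after \<open>m\<close>. Exchanging the order of summation counts the entry at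
  \<open>j\<close> with the weights of all \<open>m < j\<close>.\<close>

lemma weighted_partial_sums:
  fixes P w :: "nat \<Rightarrow> real"
  assumes w: "\<And>i. w i \<ge> 0" and P: "summable (\<lambda>j. \<bar>P j\<bar>)" "P sums 0"
    and s: "summable (\<lambda>j. (\<Sum>i<j. w i) * \<bar>P j\<bar>)"
  shows "summable (\<lambda>m. w m * \<bar>\<Sum>j\<le>m. P j\<bar>)"
    and "(\<Sum>m. w m * \<bar>\<Sum>j\<le>m. P j\<bar>) \<le> (\<Sum>j. (\<Sum>i<j. w i) * \<bar>P j\<bar>)"
proof -
  define W where "W j = (\<Sum>i<j. w i)" for j
  define T where "T m = (\<Sum>j. \<bar>P (j + m)\<bar>)" for m
  have T: "T m = \<bar>P m\<bar> + T (Suc m)" for m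
    unfolding T_def using suminf_split_head[of "\<lambda>j. \<bar>P (j + m)\<bar>"] P(1) summable_iff_shift[of "\<lambda>j. \<bar>P j\<bar>" m]
    by simp
  have abel: "(\<Sum>m<N. w m * T (Suc m)) = (\<Sum>j<N. W j * \<bar>P j\<bar>) + W N * T N" for N
  proof (induction N)
    case (Suc N)
    then show ?case using T[of N] by (simp add: W_def algebra_simps)
  qed (simp add: W_def)
  have W: "mono W" unfolding W_def mono_iff_le_Suc using w by simp
  have bound: "(\<Sum>m<N. w m * \<bar>\<Sum>j\<le>m. P j\<bar>) \<le> (\<Sum>j. W j * \<bar>P j\<bar>)" for N
  proof -
    have "(\<Sum>m<N. w m * \<bar>\<Sum>j\<le>m. P j\<bar>) \<le> (\<Sum>m<N. w m * T (Suc m))"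
      unfolding T_def lessThan_Suc_atMost[symmetric]
      by (intro sum_mono mult_left_mono abs_partial_sum_le_tail P w)
    also have "\<dots> \<le> (\<Sum>j. W j * \<bar>P j\<bar>)"
      using mult_tail_le[OF W _ P(1), of N] s unfolding abel by (simp add: W_def T_def)
    finally show ?thesis .
  qed
  show 1: "summable (\<lambda>m. w m * \<bar>\<Sum>j\<le>m. P j\<bar>)"
    using w bound by (intro summableI_nonneg_bounded[where x = "\<Sum>j. W j * \<bar>P j\<bar>"]) auto
  show "(\<Sum>m. w m * \<bar>\<Sum>j\<le>m. P j\<bar>) \<le> (\<Sum>j. (\<Sum>i<j. w i) * \<bar>P j\<bar>)"
    using bound unfolding W_def by (intro suminf_le_const 1)
qed

text \<open>Summation by parts; the boundary term, \<open>N\<close> times a tail of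
  \<open>P\<close>, is dominated by a tail of the convergent series of
  \<open>j * \<bar>P j\<bar>\<close>.\<close>

lemma partial_sums_sums:
  fixes P :: "nat \<Rightarrow> real"
  assumes P: "summable (\<lambda>j. \<bar>P j\<bar>)" "P sums 0" and s: "summable (\<lambda>j. real j * \<bar>P j\<bar>)"
    and t: "(\<lambda>j. real j * P j) sums t"
  shows "(\<lambda>m. \<Sum>j\<le>m. P j) sums (- t)"
proof -
  have id: "(\<Sum>m<N. \<Sum>j\<le>m. P j) = real N * (\<Sum>j<N. P j) - (\<Sum>j<N. real j * P j)" for N
    by (induction N) (auto simp: algebra_simps simp flip: lessThan_Suc_atMost)
  have "(\<lambda>N. real N * (\<Sum>j<N. P j)) \<longlonglongrightarrow> 0"
  proof (rule Lim_null_comparison)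
    show "\<forall>\<^sub>F N in sequentially. norm (real N * (\<Sum>j<N. P j)) \<le> (\<Sum>j. real j * \<bar>P j\<bar>) - (\<Sum>j<N. real j * \<bar>P j\<bar>)"
    proof (intro always_eventually allI)
      fix N
      have "norm (real N * (\<Sum>j<N. P j)) \<le> real N * (\<Sum>j. \<bar>P (j + N)\<bar>)"
        using abs_partial_sum_le_tail[OF P, of N] by (simp add: abs_mult mult_left_mono)
      also have "\<dots> \<le> (\<Sum>j. real j * \<bar>P j\<bar>) - (\<Sum>j<N. real j * \<bar>P j\<bar>)"
        by (rule mult_tail_le[OF _ _ P(1) s]) (auto simp: mono_def)
      finally show "norm (real N * (\<Sum>j<N. P j)) \<le> (\<Sum>j. real j * \<bar>P j\<bar>) - (\<Sum>j<N. real j * \<bar>P j\<bar>)" .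
    qed
    have "(\<lambda>N. (\<Sum>j. real j * \<bar>P j\<bar>) - (\<Sum>j<N. real j * \<bar>P j\<bar>)) \<longlonglongrightarrow> (\<Sum>j. real j * \<bar>P j\<bar>) - (\<Sum>j. real j * \<bar>P j\<bar>)"
      by (intro tendsto_diff tendsto_const summable_LIMSEQ s)
    then show "(\<lambda>N. (\<Sum>j. real j * \<bar>P j\<bar>) - (\<Sum>j<N. real j * \<bar>P j\<bar>)) \<longlonglongrightarrow> 0" by simp
  qed
  from tendsto_diff[OF this t[unfolded sums_def]] show ?thesis unfolding sums_def id by simp
qed

text \<open>Dividing by \<open>1 - X\<close> means taking partial sums, and the two hypotheses on
  sums say that \<open>P\<close> and its derivative vanish at 1. Going back from \<open>Q\<close> to
  \<open>S\<close> to \<open>P\<close>, the weight 1 becomes \<open>j\<close> and then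
  \<open>j * (j - 1) / 2\<close>, whence the factor 1/2.\<close>

lemma factor_one_minus_X_squared:
  fixes P :: "real fps"
  assumes s: "summable (\<lambda>j. real j * (real j - 1) * \<bar>fps_nth P j\<bar>)"
    and P0: "fps_nth P sums 0" and P1: "(\<lambda>j. real j * fps_nth P j) sums 0"
  shows "\<exists>Q. P = (1 - fps_X)\<^sup>2 * Q \<and> l1 Q \<and>
    norm1 Q \<le> (\<Sum>j. real j * (real j - 1) * \<bar>fps_nth P j\<bar>) / 2"
proof -
  define S where "S = Abs_fps (\<lambda>m. \<Sum>j\<le>m. fps_nth P j)"
  define Q where "Q = Abs_fps (\<lambda>m. \<Sum>j\<le>m. fps_nth S j)"
  have abs1: "summable (\<lambda>j. \<bar>G j\<bar>)" if "summable (\<lambda>j. real j * \<bar>G j\<bar>)" for G :: "nat \<Rightarrow> real"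
    by (rule summable_comparison_test'[OF that, of 1]) (auto simp: mult_le_cancel_right1)
  have s1: "summable (\<lambda>j. real j * \<bar>fps_nth P j\<bar>)"
  proof (rule summable_comparison_test'[OF s, of 2])
    fix j :: nat assume "j \<ge> 2"
    then have "real j * 1 \<le> real j * (real j - 1)" by (intro mult_left_mono) auto
    then have "real j * \<bar>fps_nth P j\<bar> \<le> real j * (real j - 1) * \<bar>fps_nth P j\<bar>"
      by (intro mult_right_mono) auto
    then show "norm (real j * \<bar>fps_nth P j\<bar>) \<le> real j * (real j - 1) * \<bar>fps_nth P j\<bar>" by simp
  qed
  note s0 = abs1[OF s1]
  have gauss: "(\<Sum>i<j. real i) = real j * (real j - 1) / 2" for j :: nat
    by (induction j) (auto simp: field_simps)
  have "summable (\<lambda>j. (\<Sum>i<j. real i) * \<bar>fps_nth P j\<bar>)"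
    unfolding gauss using summable_divide[OF s, of 2] by simp
  from weighted_partial_sums[of real, OF _ s0 P0 this]
  have S1: "summable (\<lambda>m. real m * \<bar>fps_nth S m\<bar>)"
    and S2: "(\<Sum>m. real m * \<bar>fps_nth S m\<bar>) \<le> (\<Sum>j. real j * (real j - 1) / 2 * \<bar>fps_nth P j\<bar>)"
    by (auto simp: S_def gauss)
  have "fps_nth S = (\<lambda>m. \<Sum>j\<le>m. fps_nth P j)" by (simp add: S_def fun_eq_iff)
  then have S0: "fps_nth S sums 0"
    using partial_sums_sums[OF s0 P0 s1 P1] by simp
  note S3 = abs1[OF S1]
  have "l1 Q" "norm1 Q \<le> (\<Sum>m. real m * \<bar>fps_nth S m\<bar>)"
    using weighted_partial_sums[of "\<lambda>_. 1", OF _ S3 S0] S1 by (auto simp: l1_def norm1_def Q_def)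
  moreover have "(\<Sum>j. real j * (real j - 1) / 2 * \<bar>fps_nth P j\<bar>) = (\<Sum>j. real j * (real j - 1) * \<bar>fps_nth P j\<bar>) / 2"
    using suminf_divide[OF s, of 2] by simp
  moreover have "P = (1 - fps_X)\<^sup>2 * Q"
    using one_minus_X_mult_partial_sums[of P] one_minus_X_mult_partial_sums[of S]
    by (simp add: S_def[symmetric] Q_def[symmetric] power2_eq_square mult.assoc)
  ultimately show ?thesis using S2 by auto
qed

subsection \<open>Generating functions\<close>

lemma fps_mult_powser_sums:
  fixes A F :: "real fps"
  assumes "summable (\<lambda>n. \<bar>fps_nth A n * z ^ n\<bar>)" "summable (\<lambda>n. \<bar>fps_nth F n * z ^ n\<bar>)"
  shows "(\<lambda>n. fps_nth (A * F) n * z ^ n) sums ((\<Sum>n. fps_nth A n * z ^ n) * (\<Sum>n. fps_nth F n * z ^ n))"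
proof -
  have "(\<lambda>k. \<Sum>i\<le>k. (fps_nth A i * z ^ i) * (fps_nth F (k - i) * z ^ (k - i))) sums
      ((\<Sum>n. fps_nth A n * z ^ n) * (\<Sum>n. fps_nth F n * z ^ n))"
    using assms by (intro Cauchy_product_sums) auto
  moreover have "(\<Sum>i\<le>k. (fps_nth A i * z ^ i) * (fps_nth F (k - i) * z ^ (k - i))) = fps_nth (A * F) k * z ^ k" for k
    unfolding fps_mult_nth atLeast0AtMost sum_distrib_right
  proof (intro sum.cong refl)
    fix i assume "i \<in> {..k}"
    then have "z ^ k = z ^ i * z ^ (k - i)" by (simp flip: power_add)
    then show "fps_nth A i * z ^ i * (fps_nth F (k - i) * z ^ (k - i)) = fps_nth A i * fps_nth F (k - i) * z ^ k"
      by simp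
  qed
  ultimately show ?thesis by simp
qed

text \<open>An identity theorem from positive arguments alone: once the lowest power is divided out,
  the limit at 0 from the right would be the nonzero leading coefficient.\<close>

lemma fps_eq_0_if_sums_0_right:
  fixes C :: "real fps"
  assumes r: "r > 0" and z: "\<And>z. 0 < z \<Longrightarrow> z < r \<Longrightarrow> (\<lambda>n. fps_nth C n * z ^ n) sums 0"
  shows "C = 0"
proof (rule ccontr)
  assume C: "C \<noteq> 0"
  define d where "d = subdegree C"
  define D where "D = fps_shift d C"
  have D0: "fps_nth D 0 \<noteq> 0" using C by (simp add: D_def d_def)
  have Dz: "(\<lambda>n. fps_nth D n * z ^ n) sums 0" if "0 < z" "z < r" for z
  proof -
    have "(\<lambda>n. fps_nth C (n + d) * z ^ (n + d)) sums (0 - (\<Sum>i<d. fps_nth C i * z ^ i))"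
      by (rule sums_split_initial_segment[OF z[OF that]])
    moreover have "fps_nth C i = 0" if "i < d" for i
      using that unfolding d_def by (rule nth_less_subdegree_zero)
    ultimately have "(\<lambda>n. fps_nth C (n + d) * z ^ (n + d)) sums 0" by simp
    then have "(\<lambda>n. fps_nth D n * z ^ n * z ^ d) sums 0"
      by (simp add: D_def power_add mult.assoc)
    from sums_divide[OF this, of "z ^ d"] show ?thesis using that by simp
  qed
  let ?f = "\<lambda>x. \<Sum>n. fps_nth D n * x ^ n"
  have "(?f \<longlongrightarrow> fps_nth D 0) (at 0)"
  proof (rule powser_limit_0[of "r / 2"])
    fix x :: real assume "norm x < r / 2"
    then show "(\<lambda>n. fps_nth D n * x ^ n) sums ?f x"
      using r Dz[of "r / 2"] powser_inside[of "fps_nth D" "r / 2" x] by (auto simp: sums_iff)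
  qed (use r in simp)
  then have "(?f \<longlongrightarrow> fps_nth D 0) (at_right 0)"
    by (rule filterlim_mono) (auto simp: at_le)
  moreover have "\<forall>\<^sub>F x in at_right 0. ?f x = 0"
    unfolding eventually_at_right_field using r Dz by (intro exI[of _ r]) (auto simp: sums_iff)
  then have "(?f \<longlongrightarrow> 0) (at_right 0)" by (rule tendsto_eventually)
  ultimately have "fps_nth D 0 = 0" using tendsto_unique trivial_limit_at_right_real by blast
  with D0 show False by simp
qed

context
  fixes F :: "real fps"
  assumes F: "\<And>k. 0 \<le> fps_nth F k" "fps_nth F sums 1"
begin

lemma pmf_powser_summable: "\<bar>z\<bar> \<le> 1 \<Longrightarrow> summable (\<lambda>n. \<bar>fps_nth F n * z ^ n\<bar>)"
  by (rule summable_comparison_test'[OF sums_summable[OF F(2)], of 0])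
     (use F(1) in \<open>auto simp: abs_mult power_abs power_le_one intro!: mult_left_le\<close>)

lemma pmf_powser_pos:
  assumes "0 < z" "z \<le> 1"
  shows "0 < (\<Sum>n. fps_nth F n * z ^ n)"
proof -
  have "\<exists>k. fps_nth F k \<noteq> 0"
  proof (rule ccontr)
    assume "\<nexists>k. fps_nth F k \<noteq> 0"
    then have "fps_nth F = (\<lambda>_. 0)" by auto
    then show False using F(2) by (simp add: sums_iff)
  qed
  then obtain k where "fps_nth F k > 0" using F(1) by (metis order_le_less)
  then show ?thesis using F(1) assms summable_rabs_cancel[OF pmf_powser_summable[of z]]
    by (intro suminf_pos2[of _ k]) auto
qed

lemma pmf_powser_le_1:
  assumes "0 < z" "z \<le> 1"
  shows "(\<Sum>n. fps_nth F n * z ^ n) \<le> 1"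
  by (rule sums_le[OF _ summable_sums F(2)])
    (use F(1) assms summable_rabs_cancel[OF pmf_powser_summable[of z]] in
      \<open>auto intro!: mult_left_le power_le_one\<close>)

lemma pmf_powser_deriv:
  assumes "\<bar>z\<bar> < 1"
  shows "(\<lambda>n. fps_nth (fps_deriv F) n * z ^ n) sums deriv (pgf (fps_nth F)) z"
proof -
  have "DERIV (\<lambda>x. \<Sum>n. fps_nth F n * x ^ n) z :> (\<Sum>n. diffs (fps_nth F) n * z ^ n)"
    by (rule termdiffs_strong[of _ 1]) (use assms F(2) in \<open>auto simp: sums_iff\<close>)
  then have "deriv (pgf (fps_nth F)) z = (\<Sum>n. diffs (fps_nth F) n * z ^ n)"
    unfolding pgf_def by (rule DERIV_imp_deriv)
  moreover have "summable (\<lambda>n. diffs (fps_nth F) n * z ^ n)"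
  proof (rule termdiff_converges[of _ 1])
    fix x :: real assume "norm x < 1"
    then show "summable (\<lambda>n. fps_nth F n * x ^ n)"
      using summable_rabs_cancel[OF pmf_powser_summable[of x]] by simp
  qed (use assms in simp)
  ultimately show ?thesis by (simp add: diffs_def sums_iff)
qed

text \<open>The quotient is cleared only at positive \<open>z\<close>, where the generating function
  is positive and no division by 0 can occur. Agreement there already forces equality of the formal
  series.\<close>

lemma log_derivative_recurrence:
  fixes A :: "real fps"
  assumes r: "r > 0"
    and A: "\<And>z. \<bar>z\<bar> < r \<Longrightarrow> (\<lambda>m. fps_nth A m * z ^ m) sums (deriv (pgf (fps_nth F)) z / pgf (fps_nth F) z)"
  shows "fps_deriv F = A * F"
proof -
  have "A * F - fps_deriv F = 0"
  proof (rule fps_eq_0_if_sums_0_right)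
    show "min r 1 > 0" using r by simp
    fix z :: real assume z: "0 < z" "z < min r 1"
    have "summable (\<lambda>n. norm (fps_nth A n * z ^ n))"
      by (rule powser_insidea[of _ "(z + r) / 2"]) (use A[of "(z + r) / 2"] z in \<open>auto simp: sums_iff\<close>)
    then have "(\<lambda>n. fps_nth (A * F) n * z ^ n) sums ((\<Sum>n. fps_nth A n * z ^ n) * (\<Sum>n. fps_nth F n * z ^ n))"
      by (intro fps_mult_powser_sums pmf_powser_summable) (use z in auto)
    also have "(\<Sum>n. fps_nth A n * z ^ n) = deriv (pgf (fps_nth F)) z / (\<Sum>n. fps_nth F n * z ^ n)"
      using A[of z] z by (simp add: sums_iff pgf_def)
    finally have "(\<lambda>n. fps_nth (A * F) n * z ^ n) sums deriv (pgf (fps_nth F)) z"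
      using pmf_powser_pos[of z] z by simp
    from sums_diff[OF this pmf_powser_deriv[of z]]
    show "(\<lambda>n. fps_nth (A * F - fps_deriv F) n * z ^ n) sums 0"
      using z by (simp add: algebra_simps)
  qed
  then show ?thesis by simp
qed

text \<open>Inside the unit disc the value of \<open>A\<close> at \<open>z\<close> is an average of
  its partial sums with weights \<open>(1 - z) * z ^ n\<close>. An upper bound on it suffices,
  because the terms of the derivative of \<open>F\<close> are nonnegative and finitely many of them
  survive the limit \<open>z\<close> to 1.\<close>

lemma partial_mean_le:
  fixes A :: "real fps"
  assumes eq: "fps_deriv F = A * F" and A: "fps_nth A sums \<mu>"
  shows "(\<Sum>k<K. real k * fps_nth F k) \<le> \<mu>"
proof (rule dense_ge)
  fix c assume "\<mu> < c"
  define s where "s n = (\<Sum>i\<le>n. fps_nth A i)" for n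
  have "s \<longlonglongrightarrow> \<mu>" unfolding s_def using A by (simp add: sums_def_le)
  then have "\<forall>\<^sub>F n in sequentially. s n < c" using \<open>\<mu> < c\<close> by (rule order_tendstoD)
  then obtain N where N: "\<And>n. n \<ge> N \<Longrightarrow> s n < c" by (auto simp: eventually_sequentially)
  \<comment> \<open>\<open>B\<close> collects the excess of the finitely many early partial sums
    over \<open>c\<close>; it enters with the factor \<open>1 - z\<close> and vanishes in the
    limit.\<close>
  define B where "B = (\<Sum>n<N. \<bar>s n - c\<bar>)"
  have up: "(\<Sum>k<K. fps_nth (fps_deriv F) k * z ^ k) \<le> c + (1 - z) * B" if z: "0 < z" "z < 1" for z
  proof -
    define a where "a = (\<Sum>n. fps_nth A n * z ^ n)"
    have A1: "summable (\<lambda>n. \<bar>fps_nth A n * z ^ n\<bar>)"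
      using powser_insidea[of "fps_nth A" 1 z] A z by (simp add: sums_iff)
    have geo: "summable (\<lambda>n. \<bar>z ^ n\<bar>)" using z by (simp add: summable_geometric)
    have "(\<lambda>n. fps_nth (A * Abs_fps (\<lambda>_. 1)) n * z ^ n) sums (a * (\<Sum>n. fps_nth (Abs_fps (\<lambda>_. 1)) n * z ^ n))"
      unfolding a_def by (rule fps_mult_powser_sums[OF A1]) (use geo in simp)
    then have "(\<lambda>n. s n * z ^ n) sums (a * (1 / (1 - z)))"
      using z by (simp add: fps_mult_nth s_def suminf_geometric atLeast0AtMost)
    then have "(\<lambda>n. (1 - z) * (s n * z ^ n)) sums a"
      using sums_mult[of _ _ "1 - z"] z by fastforce
    moreover have "(\<lambda>n. (1 - z) * (c * z ^ n + (if n \<in> {..<N} then \<bar>s n - c\<bar> else 0))) sums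
        ((1 - z) * (c * (1 / (1 - z)) + B))"
      unfolding B_def using z by (intro sums_mult sums_add geometric_sums sums_If_finite_set) auto
    moreover have "(1 - z) * (s n * z ^ n) \<le> (1 - z) * (c * z ^ n + (if n \<in> {..<N} then \<bar>s n - c\<bar> else 0))" for n
    proof -
      have "(s n - c) * z ^ n \<le> (if n \<in> {..<N} then \<bar>s n - c\<bar> else 0)"
      proof (cases "n < N")
        case True
        have "(s n - c) * z ^ n \<le> \<bar>s n - c\<bar> * z ^ n" using z by (intro mult_right_mono) auto
        also have "\<dots> \<le> \<bar>s n - c\<bar>" using z by (intro mult_left_le power_le_one) auto
        finally show ?thesis using True by simp
      next
        case False
        then show ?thesis using N[of n] z by (auto intro!: mult_nonpos_nonneg)
      qed
      then show ?thesis using z by (intro mult_left_mono) (auto simp: algebra_simps)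
    qed
    ultimately have "a \<le> (1 - z) * (c * (1 / (1 - z)) + B)" by (rule sums_le[rotated 1])
    also have "\<dots> = c + (1 - z) * B" using z by (simp add: field_simps)
    finally have a: "a \<le> c + (1 - z) * B" .
    have "(\<lambda>n. fps_nth (fps_deriv F) n * z ^ n) sums (a * (\<Sum>n. fps_nth F n * z ^ n))"
      unfolding eq a_def using z by (intro fps_mult_powser_sums A1 pmf_powser_summable) auto
    then have d: "summable (\<lambda>n. fps_nth (fps_deriv F) n * z ^ n)"
      "(\<Sum>n. fps_nth (fps_deriv F) n * z ^ n) = a * (\<Sum>n. fps_nth F n * z ^ n)"
      by (auto simp: sums_iff)
    have pos: "0 \<le> fps_nth (fps_deriv F) n * z ^ n" for n using F(1) z by simp
    have le: "(\<Sum>k<K. fps_nth (fps_deriv F) k * z ^ k) \<le> a * (\<Sum>n. fps_nth F n * z ^ n)"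
      unfolding d(2)[symmetric] by (rule sum_le_suminf[OF d(1)]) (use pos in auto)
    have "0 \<le> a * (\<Sum>n. fps_nth F n * z ^ n)"
      unfolding d(2)[symmetric] by (rule suminf_nonneg[OF d(1) pos])
    \<comment> \<open>The coefficients of \<open>A\<close> may be negative, so the sign of
      \<open>a\<close> is read off from the product. It is needed to drop the factor that is at most
      1.\<close>
    then have "a \<ge> 0" using pmf_powser_pos[of z] z by (simp add: zero_le_mult_iff)
    then have "a * (\<Sum>n. fps_nth F n * z ^ n) \<le> a"
      using pmf_powser_le_1[of z] z by (intro mult_left_le) auto
    with le a show ?thesis by linarith
  qed
  have "(\<Sum>k<K. fps_nth (fps_deriv F) k * 1 ^ k) \<le> c + (1 - 1) * B"
  proof (rule tendsto_le)
    show "((\<lambda>z. c + (1 - z) * B) \<longlongrightarrow> c + (1 - 1) * B) (at_left (1::real))"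
      by (intro tendsto_intros)
    show "((\<lambda>z. \<Sum>k<K. fps_nth (fps_deriv F) k * z ^ k) \<longlongrightarrow> (\<Sum>k<K. fps_nth (fps_deriv F) k * 1 ^ k)) (at_left (1::real))"
      by (intro tendsto_intros)
    show "\<forall>\<^sub>F z in at_left 1. (\<Sum>k<K. fps_nth (fps_deriv F) k * z ^ k) \<le> c + (1 - z) * B"
      unfolding eventually_at_left_field using up by (intro exI[of _ 0]) auto
  qed simp
  moreover have "(\<Sum>k<K. real k * fps_nth F k) \<le> (\<Sum>k<Suc K. real k * fps_nth F k)"
    using F(1) by simp
  moreover have "(\<Sum>k<Suc K. real k * fps_nth F k) = (\<Sum>k<K. fps_nth (fps_deriv F) k)"
    by (subst sum.lessThan_Suc_shift) simp
  ultimately show "(\<Sum>k<K. real k * fps_nth F k) \<le> c" by simp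
qed

end


subsection \<open>The law of a sum of independent variables\<close>

lemma (in prob_space) fps_dist_nat_sum:
  fixes X :: "'i \<Rightarrow> 'a \<Rightarrow> nat"
  assumes "finite I" "indep_vars (\<lambda>_. count_space UNIV) X I"
  shows "Abs_fps (dist_nat M (\<lambda>\<omega>. \<Sum>i\<in>I. X i \<omega>)) = (\<Prod>i\<in>I. Abs_fps (dist_nat M (X i)))"
  using assms
proof (induction I rule: finite_induct)
  case empty
  show ?case by (rule fps_ext) (auto simp: dist_nat_def prob_space)
next
  case (insert i I)
  \<comment> \<open>The variables are cast to reals so that \<open>indep_vars_sum\<close> separates
    one of them from the sum of the others.\<close>
  have "indep_vars (\<lambda>_. borel) (\<lambda>j \<omega>. real (X j \<omega>)) (insert i I)"
    by (rule indep_vars_compose2[OF insert.prems]) simp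
  then have ind: "indep_var borel (\<lambda>\<omega>. real (X i \<omega>)) borel (\<lambda>\<omega>. \<Sum>j\<in>I. real (X j \<omega>))"
    by (rule indep_vars_sum[OF insert.hyps])
  let ?S = "\<lambda>\<omega>. \<Sum>j\<in>I. X j \<omega>"
  have joint: "prob {\<omega> \<in> space M. X i \<omega> = j \<and> ?S \<omega> = l} = dist_nat M (X i) j * dist_nat M ?S l" for j l
  proof -
    have "{\<omega> \<in> space M. X i \<omega> = j \<and> ?S \<omega> = l} =
        (\<lambda>\<omega>. (real (X i \<omega>), \<Sum>j\<in>I. real (X j \<omega>))) -` ({real j} \<times> {real l}) \<inter> space M"
      by (auto simp flip: of_nat_sum)
    also have "prob \<dots> = prob ((\<lambda>\<omega>. real (X i \<omega>)) -` {real j} \<inter> space M)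
        * prob ((\<lambda>\<omega>. \<Sum>j\<in>I. real (X j \<omega>)) -` {real l} \<inter> space M)"
      by (rule indep_varD[OF ind]) auto
    also have "(\<lambda>\<omega>. real (X i \<omega>)) -` {real j} \<inter> space M = {\<omega> \<in> space M. X i \<omega> = j}" by auto
    also have "(\<lambda>\<omega>. \<Sum>j\<in>I. real (X j \<omega>)) -` {real l} \<inter> space M = {\<omega> \<in> space M. ?S \<omega> = l}"
      by (auto simp flip: of_nat_sum)
    finally show ?thesis by (simp add: dist_nat_def)
  qed
  have "X j \<in> measurable M (count_space UNIV)" if "j \<in> insert i I" for j
    using insert.prems that by (auto simp: indep_vars_def)
  then have meas[measurable]: "X i \<in> measurable M (count_space UNIV)" "?S \<in> measurable M (count_space UNIV)"
    by (auto intro!: measurable_sum_nat)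
  have "dist_nat M (\<lambda>\<omega>. X i \<omega> + ?S \<omega>) k = (\<Sum>j\<le>k. dist_nat M (X i) j * dist_nat M ?S (k - j))" for k
  proof -
    have "{\<omega> \<in> space M. X i \<omega> + ?S \<omega> = k} = (\<Union>j\<in>{..k}. {\<omega> \<in> space M. X i \<omega> = j \<and> ?S \<omega> = k - j})"
      by auto
    moreover have "prob \<dots> = (\<Sum>j\<le>k. prob {\<omega> \<in> space M. X i \<omega> = j \<and> ?S \<omega> = k - j})"
      by (rule finite_measure_finite_Union) (auto simp: disjoint_family_on_def)
    ultimately show ?thesis unfolding joint by (simp add: dist_nat_def)
  qed
  then have "Abs_fps (dist_nat M (\<lambda>\<omega>. X i \<omega> + ?S \<omega>)) = Abs_fps (dist_nat M (X i)) * Abs_fps (dist_nat M ?S)"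
    by (intro fps_ext) (simp add: fps_mult_nth atLeast0AtMost)
  moreover have "Abs_fps (dist_nat M ?S) = (\<Prod>i\<in>I. Abs_fps (dist_nat M (X i)))"
    using insert.prems by (intro insert.IH) (rule indep_vars_subset, auto)
  ultimately show ?case using insert.hyps by simp
qed

lemma (in prob_space) dist_nat_sums:
  assumes "V \<in> measurable M (count_space UNIV)"
  shows "dist_nat M V sums 1"
proof -
  have "(\<lambda>k. prob {\<omega> \<in> space M. V \<omega> = k}) sums prob (\<Union>k. {\<omega> \<in> space M. V \<omega> = k})"
    by (rule finite_measure_UNION) (use assms in \<open>auto simp: disjoint_family_on_def\<close>)
  moreover have "(\<Union>k. {\<omega> \<in> space M. V \<omega> = k}) = space M" by auto
  ultimately show ?thesis by (simp add: dist_nat_def[abs_def] prob_space)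
qed

subsection \<open>Negative binomial approximation\<close>

text \<open>From \<open>\<bar>x - y\<bar> = x + y - 2 * min x y\<close>. The boundary term
  \<open>f 0\<close> of the comparison with the shift supplies the mass missing from the sum over
  successors.\<close>

lemma overlap_sums:
  fixes f :: "nat \<Rightarrow> real"
  assumes f: "\<And>k. 0 \<le> f k" "f sums 1"
  shows "(\<lambda>k. min (f k) (f (Suc k))) sums (1 - dtv f (shift1 f))"
proof -
  have 0: "(\<lambda>k. f (Suc k)) sums (1 - f 0)"
    using sums_split_initial_segment[OF f(2), of 1] by simp
  have s: "summable (\<lambda>k. min (f k) (f (Suc k)))"
    by (rule summable_comparison_test'[OF sums_summable[OF f(2)], of 0]) (use f(1) in \<open>auto simp: min_def\<close>)
  define t where "t = (\<Sum>k. min (f k) (f (Suc k)))"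
  have t: "(\<lambda>k. min (f k) (f (Suc k))) sums t" unfolding t_def by (rule summable_sums[OF s])
  have "(\<lambda>k. f (Suc k) + f k - 2 * min (f k) (f (Suc k))) sums (1 - f 0 + 1 - 2 * t)"
    by (intro sums_diff sums_add sums_mult 0 f(2) t)
  moreover have "(\<lambda>k. f (Suc k) + f k - 2 * min (f k) (f (Suc k))) = (\<lambda>k. \<bar>f (Suc k) - shift1 f (Suc k)\<bar>)"
    by (auto simp: shift1_def min_def fun_eq_iff)
  ultimately have "(\<lambda>k. \<bar>f (Suc k) - shift1 f (Suc k)\<bar>) sums (2 - f 0 - 2 * t)" by simp
  then have "(\<lambda>k. \<bar>f k - shift1 f k\<bar>) sums (2 - 2 * t)"
    using sums_Suc_iff[of "\<lambda>k. \<bar>f k - shift1 f k\<bar>"] f(1)[of 0] by (simp add: shift1_def)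
  then have "dtv f (shift1 f) = 1 - t" by (simp add: dtv_def sums_iff)
  then show ?thesis using t by simp
qed

lemma fps_deriv_prod:
  fixes F A :: "'i \<Rightarrow> real fps"
  assumes "finite I" "\<And>i. i \<in> I \<Longrightarrow> fps_deriv (F i) = A i * F i"
  shows "fps_deriv (\<Prod>i\<in>I. F i) = (\<Sum>i\<in>I. A i) * (\<Prod>i\<in>I. F i)"
  using assms by (induction I rule: finite_induct) (auto simp: algebra_simps)

lemma nb_approximation:
  fixes F A :: "real fps" and \<mu> \<mu>2 :: real
  assumes F: "\<And>k. 0 \<le> fps_nth F k" "fps_nth F sums 1"
    and eq: "fps_deriv F = A * F"
    and A0: "fps_nth A sums \<mu>" and A1: "(\<lambda>m. real m * fps_nth A m) sums \<mu>2"
    and \<mu>2: "\<mu>2 > 0"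
  defines "p \<equiv> \<mu> / (\<mu> + \<mu>2)" and "q \<equiv> 1 - \<mu> / (\<mu> + \<mu>2)" and "\<alpha> \<equiv> \<mu>\<^sup>2 / \<mu>2"
  assumes s: "summable (\<lambda>l. real l * (real l - 1) * \<bar>fps_nth A l - q * fps_nth A (l - 1)\<bar>)"
  shows "\<mu> > 0" "dtv (fps_nth F) (nb_pmf \<alpha> p) \<le> 1 / (\<alpha> * q) *
    ((\<Sum>l. real l * (real l - 1) * \<bar>fps_nth A l - q * fps_nth A (l - 1)\<bar>) / 2) * norm1 (F * (1 - fps_X))"
proof -
  note mean = partial_mean_le[OF F eq A0]
  show \<mu>: "\<mu> > 0"
  \<comment> \<open>If the mean were nonpositive, \<open>F\<close> would be concentrated at 0, so
    \<open>A = 0\<close>, contradicting \<open>\<mu>2 > 0\<close>.\<close>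
  proof (rule ccontr)
    assume "\<not> \<mu> > 0"
    have "fps_nth F k = 0" if "k > 0" for k
    proof -
      have "real k * fps_nth F k \<le> (\<Sum>j<Suc k. real j * fps_nth F j)"
        using F(1) by (simp add: sum_nonneg)
      also have "\<dots> \<le> 0" using mean[of "Suc k"] \<open>\<not> \<mu> > 0\<close> by linarith
      finally show ?thesis using that F(1)[of k] by (simp add: mult_le_0_iff)
    qed
    then have "fps_deriv F = 0" by (intro fps_ext) simp
    moreover have "F \<noteq> 0"
    proof
      assume "F = 0"
      then have "fps_nth F = (\<lambda>_. 0)" by auto
      then show False using F(2) by (simp add: sums_iff)
    qed
    ultimately have "A = 0" using eq by simp
    then show False using A1 \<mu>2 by (simp add: sums_iff)
  qed
  have q: "q = \<mu>2 / (\<mu> + \<mu>2)" and p: "0 < p" "p < 1" "1 - p = q" and \<alpha>: "\<alpha> > 0"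
    using \<mu> \<mu>2 by (auto simp: q_def p_def \<alpha>_def field_simps)
  have q01: "0 < q" "q < 1" using p by auto
  interpret nb: neg_binomial \<alpha> q "nb_pmf \<alpha> p"
    using neg_binomial_nb_pmf[OF \<alpha> p(1,2)] p(3) by simp
  define P where "P = fps_const (q * \<alpha>) - (1 - fps_const q * fps_X) * A"
  have P_0: "fps_nth P 0 = q * \<alpha> - fps_nth A 0" by (simp add: P_def)
  have P_Suc: "fps_nth P (Suc l) = - (fps_nth A (Suc l) - q * fps_nth A l)" for l
  proof -
    have "P = fps_const (q * \<alpha>) - A + fps_const q * (fps_X * A)" by (simp add: P_def algebra_simps)
    then show ?thesis by simp
  qed
  \<comment> \<open>At \<open>l = 0\<close> the subtraction truncates, and the constant coefficient
    of \<open>P\<close> has another form; the weight is 0 there.\<close>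
  have absP: "real l * (real l - 1) * \<bar>fps_nth P l\<bar> = real l * (real l - 1) * \<bar>fps_nth A l - q * fps_nth A (l - 1)\<bar>" for l
    by (cases l) (simp, simp only: P_Suc diff_Suc_1 abs_minus_cancel)
  have "(\<lambda>l. fps_nth A (Suc l)) sums (\<mu> - fps_nth A 0)"
    using sums_split_initial_segment[OF A0, of 1] by simp
  then have "(\<lambda>l. fps_nth P (Suc l)) sums - (\<mu> - fps_nth A 0 - q * \<mu>)"
    unfolding P_Suc by (intro sums_minus sums_diff sums_mult A0)
  then have "fps_nth P sums (- (\<mu> - fps_nth A 0 - q * \<mu>) + fps_nth P 0)"
    by (simp only: sums_Suc_iff)
  \<comment> \<open>This identity makes \<open>P\<close> vanish at 1; its companion
    \<open>q * (\<mu>2 + \<mu>) = \<mu>2\<close> below does the same for the derivative. They are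
    what matching mean and variance amounts to.\<close>
  moreover have "q * \<alpha> = \<mu> - q * \<mu>"
  proof -
    have "q * \<alpha> = \<mu> * (\<mu> / (\<mu> + \<mu>2))" using \<mu>2 by (simp add: q \<alpha>_def power2_eq_square)
    also have "\<mu> / (\<mu> + \<mu>2) = 1 - q" by (simp add: q_def)
    finally show ?thesis by (simp add: algebra_simps)
  qed
  ultimately have P0: "fps_nth P sums 0" by (simp add: P_0)
  have "(\<lambda>l. real (Suc l) * fps_nth A (Suc l)) sums \<mu>2"
    using sums_split_initial_segment[OF A1, of 1] by simp
  moreover have "(\<lambda>l. q * (real l * fps_nth A l + fps_nth A l)) sums (q * (\<mu>2 + \<mu>))"
    by (intro sums_mult sums_add A0 A1)
  ultimately have "(\<lambda>l. - (real (Suc l) * fps_nth A (Suc l) - q * (real l * fps_nth A l + fps_nth A l))) sums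
      - (\<mu>2 - q * (\<mu>2 + \<mu>))"
    by (intro sums_minus sums_diff)
  moreover have "q * (\<mu>2 + \<mu>) = \<mu>2" using \<mu> \<mu>2 by (simp add: q field_simps)
  moreover have "- (real (Suc l) * fps_nth A (Suc l) - q * (real l * fps_nth A l + fps_nth A l)) = real (Suc l) * fps_nth P (Suc l)" for l
    unfolding P_Suc by (simp add: algebra_simps)
  ultimately have "(\<lambda>l. real (Suc l) * fps_nth P (Suc l)) sums 0" by simp
  then have P1: "(\<lambda>l. real l * fps_nth P l) sums 0"
    using sums_Suc_iff[of "\<lambda>l. real l * fps_nth P l" 0] by simp
  have "summable (\<lambda>l. real l * (real l - 1) * \<bar>fps_nth P l\<bar>)" unfolding absP by (rule s)
  from factor_one_minus_X_squared[OF this P0 P1] obtain Q where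
    Q: "P = (1 - fps_X)\<^sup>2 * Q" "l1 Q"
      "norm1 Q \<le> (\<Sum>l. real l * (real l - 1) * \<bar>fps_nth A l - q * fps_nth A (l - 1)\<bar>) / 2"
    unfolding absP by blast
  define R where "R = Q * (F * (1 - fps_X))"
  have F1: "l1 F" using F by (simp add: l1_def sums_iff)
  then have FX: "l1 (F * (1 - fps_X))" by (intro l1_mult l1_diff l1_1 l1_X)
  have "dtv (fps_nth F) (nb_pmf \<alpha> p) \<le> 1 / (\<alpha> * q) * norm1 R"
    unfolding dtv_def
  proof (rule nb.stein_bound[OF F])
    show "summable (\<lambda>k. real k * fps_nth F k)"
      using mean F(1) by (intro summableI_nonneg_bounded[where x = \<mu>]) auto
    show "l1 R" unfolding R_def by (intro l1_mult Q FX)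
    have "fps_const (q * \<alpha>) * F - (1 - fps_const q * fps_X) * fps_deriv F = P * F"
      unfolding eq P_def by (simp add: algebra_simps)
    also have "\<dots> = (1 - fps_X) * R"
      unfolding Q(1) R_def by (simp only: power2_eq_square mult_ac)
    finally show "fps_const (q * \<alpha>) * F - (1 - fps_const q * fps_X) * fps_deriv F = (1 - fps_X) * R" .
  qed
  also have "\<dots> \<le> 1 / (\<alpha> * q) *
    ((\<Sum>l. real l * (real l - 1) * \<bar>fps_nth A l - q * fps_nth A (l - 1)\<bar>) / 2 * norm1 (F * (1 - fps_X)))"
    unfolding R_def using \<alpha> q01
    by (intro mult_left_mono order.trans[OF norm1_mult[OF Q(2) FX]] mult_right_mono Q(3) norm1_nonneg FX) auto
  finally show "dtv (fps_nth F) (nb_pmf \<alpha> p) \<le> 1 / (\<alpha> * q) *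
    ((\<Sum>l. real l * (real l - 1) * \<bar>fps_nth A l - q * fps_nth A (l - 1)\<bar>) / 2) * norm1 (F * (1 - fps_X))"
    by (simp only: mult.assoc)
qed

theorem theorem3p2:
  fixes M :: "'a measure" and X :: "nat \<Rightarrow> 'a \<Rightarrow> nat" and a :: "nat \<Rightarrow> nat \<Rightarrow> real"
    and n :: nat and \<mu> \<sigma>2 \<mu>2 p q \<alpha> :: real
  defines "\<mu> \<equiv> (\<Sum>i\<in>{1..n}. \<Sum>m. a i (m + 1))"
    and "\<sigma>2 \<equiv> (\<Sum>i\<in>{1..n}. \<Sum>m. real (m + 1) * a i (m + 1))"
    and "\<mu>2 \<equiv> (\<Sum>i\<in>{1..n}. \<Sum>m. real m * a i (m + 1))"
    and "p \<equiv> \<mu> / \<sigma>2" and "q \<equiv> 1 - \<mu> / \<sigma>2" and "\<alpha> \<equiv> \<mu>\<^sup>2 / \<mu>2"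
  assumes "prob_space M"
    and "prob_space.indep_vars M (\<lambda>_. count_space UNIV) X {1..n}"
    and "\<And>i. i \<in> {1..n} \<Longrightarrow> \<exists>r>0. \<forall>z::real. \<bar>z\<bar> < r \<longrightarrow>
           (\<lambda>m. a i (m + 1) * z ^ m) sums
             (deriv (pgf (dist_nat M (X i))) z / pgf (dist_nat M (X i)) z)"
    and "\<And>i. i \<in> {1..n} \<Longrightarrow> summable (\<lambda>m. a i (m + 1))"
    and "\<And>i. i \<in> {1..n} \<Longrightarrow> summable (\<lambda>m. real (m + 1) * a i (m + 1))"
    and "\<And>i. i \<in> {1..n} \<Longrightarrow>
           summable (\<lambda>l. real l * (real l - 1) * \<bar>a i (l + 1) - q * a i l\<bar>)"
    and "\<sigma>2 > \<mu>"
  shows "dtv (dist_nat M (\<lambda>\<omega>. \<Sum>i\<in>{1..n}. X i \<omega>)) (nb_pmf \<alpha> p)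
     \<le> 1 / (\<alpha> * q) * sqrt (2 / pi)
        * (1 / 4 + (\<Sum>i\<in>{1..n}. 1 - dtv (dist_nat M (X i)) (shift1 (dist_nat M (X i))))) powr (-1/2)
        * (\<Sum>i\<in>{1..n}. \<Sum>l. real l * (real l - 1) * \<bar>a i (l + 1) - q * a i l\<bar>)"
proof -
  interpret prob_space M by fact
  let ?I = "{1..n}"
  have q_def: "q = 1 - \<mu> / \<sigma>2" unfolding q_def ..
  have p_def: "p = \<mu> / \<sigma>2" unfolding p_def ..
  define F where "F i = Abs_fps (dist_nat M (X i))" for i
  define A where "A i = Abs_fps (\<lambda>m. a i (m + 1))" for i
  have F_nth: "fps_nth (F i) = dist_nat M (X i)" for i by (simp add: F_def fun_eq_iff)
  have meas: "X i \<in> measurable M (count_space UNIV)" if "i \<in> ?I" for i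
    using assms(8) that by (auto simp: indep_vars_def)
  have F0: "0 \<le> fps_nth (F i) k" for i k by (simp add: F_nth dist_nat_def)
  have F1: "fps_nth (F i) sums 1" if "i \<in> ?I" for i
    unfolding F_nth by (rule dist_nat_sums[OF meas[OF that]])
  have rec: "fps_deriv (F i) = A i * F i" if "i \<in> ?I" for i
  proof -
    obtain r where "r > 0" and r: "\<And>z::real. \<bar>z\<bar> < r \<Longrightarrow> (\<lambda>m. a i (m + 1) * z ^ m) sums
        (deriv (pgf (dist_nat M (X i))) z / pgf (dist_nat M (X i)) z)"
      using assms(9)[OF \<open>i \<in> ?I\<close>] by blast
    show ?thesis
      by (rule log_derivative_recurrence[OF F0 F1[OF that] \<open>r > 0\<close>]) (use r in \<open>simp add: A_def F_nth\<close>)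
  qed
  define AA where "AA = (\<Sum>i\<in>?I. A i)"
  define FF where "FF = Abs_fps (dist_nat M (\<lambda>\<omega>. \<Sum>i\<in>?I. X i \<omega>))"
  have FF_nth: "fps_nth FF = dist_nat M (\<lambda>\<omega>. \<Sum>i\<in>?I. X i \<omega>)" by (simp add: FF_def fun_eq_iff)
  have FF: "FF = (\<Prod>i\<in>?I. F i)"
    unfolding FF_def F_def by (rule fps_dist_nat_sum[OF _ assms(8)]) simp
  have FF0: "0 \<le> fps_nth FF k" for k by (simp add: FF_nth dist_nat_def)
  have FF1: "fps_nth FF sums 1"
    unfolding FF_nth by (rule dist_nat_sums) (use meas in \<open>auto intro!: measurable_sum_nat\<close>)
  have FFrec: "fps_deriv FF = AA * FF"
    unfolding FF AA_def by (rule fps_deriv_prod) (use rec in auto)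
  have AA_nth: "fps_nth AA m = (\<Sum>i\<in>?I. a i (m + 1))" for m
    by (simp add: AA_def A_def fps_sum_nth)
  have s0: "(\<lambda>m. a i (m + 1)) sums (\<Sum>m. a i (m + 1))" if "i \<in> ?I" for i
    by (rule summable_sums[OF assms(10)[OF that]])
  have s1: "(\<lambda>m. real (m + 1) * a i (m + 1)) sums (\<Sum>m. real (m + 1) * a i (m + 1))" if "i \<in> ?I" for i
    by (rule summable_sums[OF assms(11)[OF that]])
  have s2: "(\<lambda>m. real m * a i (m + 1)) sums
      ((\<Sum>m. real (m + 1) * a i (m + 1)) - (\<Sum>m. a i (m + 1)))" if "i \<in> ?I" for i
    using sums_diff[OF s1[OF that] s0[OF that]] by (simp add: algebra_simps)
  have AA0: "fps_nth AA sums \<mu>"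
    unfolding AA_nth \<mu>_def by (intro sums_sum s0)
  have \<mu>2: "\<mu>2 = \<sigma>2 - \<mu>"
    unfolding \<mu>2_def \<sigma>2_def \<mu>_def sum_subtractf[symmetric]
    by (intro sum.cong refl) (use s2 in \<open>auto simp: sums_iff\<close>)
  have "(\<lambda>m. \<Sum>i\<in>?I. real m * a i (m + 1)) sums \<mu>2"
    unfolding \<mu>2_def by (intro sums_sum) (use s2 in \<open>auto simp: sums_iff\<close>)
  then have AA1: "(\<lambda>m. real m * fps_nth AA m) sums \<mu>2"
    unfolding AA_nth by (simp add: sum_distrib_left)
  have \<sigma>2: "\<mu> + \<mu>2 = \<sigma>2" "\<mu>2 > 0" using \<mu>2 assms(13) by auto
  let ?t = "\<lambda>i l. real l * (real l - 1) * \<bar>a i (l + 1) - q * a i l\<bar>"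
  let ?s = "\<lambda>l. real l * (real l - 1) * \<bar>fps_nth AA l - q * fps_nth AA (l - 1)\<bar>"
  have st: "?s l \<le> (\<Sum>i\<in>?I. ?t i l)" and s_pos: "0 \<le> ?s l" for l
  proof -
    have pos: "0 \<le> real l * (real l - 1)" by (cases l) auto
    then show "0 \<le> ?s l" by simp
    show "?s l \<le> (\<Sum>i\<in>?I. ?t i l)"
    \<comment> \<open>The weight vanishes at 0, where \<open>l - 1\<close> truncates and
      \<open>a i 0\<close> is no coefficient of \<open>A i\<close>.\<close>
    proof (cases "l = 0")
      case False
      then have "fps_nth AA l - q * fps_nth AA (l - 1) = (\<Sum>i\<in>?I. a i (l + 1) - q * a i l)"
        by (simp add: AA_nth sum_subtractf sum_distrib_left)
      then have "?s l \<le> real l * (real l - 1) * (\<Sum>i\<in>?I. \<bar>a i (l + 1) - q * a i l\<bar>)"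
        using pos by (intro mult_left_mono) (auto simp only: sum_abs)
      then show ?thesis by (simp only: sum_distrib_left)
    qed simp
  qed
  have t_sums: "(\<lambda>l. \<Sum>i\<in>?I. ?t i l) sums (\<Sum>i\<in>?I. \<Sum>l. ?t i l)"
    by (intro sums_sum summable_sums assms(12))
  have s: "summable ?s"
    by (rule summable_comparison_test'[OF sums_summable[OF t_sums], of 0]) (use st s_pos in \<open>simp del: of_nat_diff\<close>)
  have s_le: "(\<Sum>l. ?s l) \<le> (\<Sum>i\<in>?I. \<Sum>l. ?t i l)"
    by (rule sums_le[OF st summable_sums[OF s] t_sums])
  have q\<sigma>: "q = 1 - \<mu> / (\<mu> + \<mu>2)" and p\<sigma>: "p = \<mu> / (\<mu> + \<mu>2)"
    unfolding \<sigma>2(1) by (simp_all add: q_def p_def)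
  note nb = nb_approximation[OF FF0 FF1 FFrec AA0 AA1 \<sigma>2(2), folded q\<sigma> p\<sigma> \<alpha>_def, OF s]
  have \<alpha>q: "0 \<le> 1 / (\<alpha> * q)"
    using nb(1) \<sigma>2 unfolding q\<sigma> \<alpha>_def by (simp add: field_simps)
  have smooth: "norm1 (FF * (1 - fps_X)) \<le> 2 * sqrt (2 / pi) *
      (1/4 + (\<Sum>i\<in>?I. 1 - dtv (dist_nat M (X i)) (shift1 (dist_nat M (X i))))) powr (-1/2)"
    (is "_ \<le> 2 * sqrt (2 / pi) * ?\<Lambda>")
    unfolding FF
    by (rule smoothing_prod) (use F0 F1 overlap_sums[OF F0 F1] in \<open>auto simp: F_nth\<close>)
  have FX: "0 \<le> norm1 (FF * (1 - fps_X))"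
    using FF0 FF1 by (intro norm1_nonneg l1_mult l1_diff l1_1 l1_X) (simp add: l1_def sums_iff)
  have t0: "0 \<le> (\<Sum>i\<in>?I. \<Sum>l. ?t i l)"
    using order.trans[OF suminf_nonneg[OF s s_pos] s_le] .
  have "dtv (fps_nth FF) (nb_pmf \<alpha> p) \<le> 1 / (\<alpha> * q) * ((\<Sum>l. ?s l) / 2) * norm1 (FF * (1 - fps_X))"
    by (rule nb(2))
  also have "\<dots> \<le> 1 / (\<alpha> * q) * ((\<Sum>i\<in>?I. \<Sum>l. ?t i l) / 2) * (2 * sqrt (2 / pi) * ?\<Lambda>)"
    using s_le t0 by (intro mult_mono mult_left_mono divide_right_mono smooth \<alpha>q mult_nonneg_nonneg FX) auto
  \<comment> \<open>The 1/2 from dividing twice by \<open>1 - X\<close> cancels the 2 by which the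
    smoothing norm exceeds a total variation distance.\<close>
  also have "\<dots> = 1 / (\<alpha> * q) * sqrt (2 / pi) * ?\<Lambda> * (\<Sum>i\<in>?I. \<Sum>l. ?t i l)" by simp
  finally show ?thesis unfolding FF_nth .
qed

end
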